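(* Let $M$ be a rooted trivalent map with boundary of degree $k$ having $n$ trivalent vertices. Then there exists a linear lambda term with $k$ free variables, $p$ applications and $q$ abstractions, for some $p,q$ with $p+q=n$, whose underlying rooted trivalent map is isomorphic to $M$ (as rooted trivalent maps with boundary), and this linear lambda term is unique up to $\alpha$-equivalence.
   Context: Lambda terms are built from variables by application $t(u)$ and abstraction $\lambda x[t]$. A context is a finite ordered list of distinct variables. The relation $\Gamma\vdash t$ is defined inductively by: $x\vdash x$; if $\Gamma\vdash t$ and $\Delta\vdash u$ with disjoint variables then $\Gamma,\Delta\vdash t(u)$; if $\Gamma,x\vdash t$ then $\Gamma\vdash\lambda x[t]$; if $\Gamma,y,x,\Delta\vdash t$ then $\Gamma,x,y,\Delta\vdash t$. A linear lambda term is a pair $(\Gamma,t)$ with $\Gamma\vdash t$; the variables of $\Gamma=(x_1,\dots,x_k)$ are its free variables. Two linear lambda terms are $\alpha$-equivalent if they differ by a series of changes of free variable (replacing $x$ by a fresh $y$ in the same position of the context and in the term) and changes of bound variable (replacing a subterm $\lambda x[u]$ by $\lambda y[u\{y/x\}]$). Let $T=\langle v,e\mid v^3=e^2=1\rangle$. A rooted trivalent map with boundary is a transitive $T$-set $M$ with a distinguished element $r$ (root) and an ordered list of distinct elements $y_1,\dots,y_k$ (boundary) such that the fixed points of $v$ are exactly $\{r\}$ and the fixed points of $e$ are exactly $\{y_1,\dots,y_k\}$; $k$ is the degree; the number of trivalent vertices is the number of $v$-orbits of size $3$. An isomorphism is a bijection commuting with $v$ and $e$, preserving the root and preserving the boundary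 list position by position. Underlying rooted trivalent map of $(\Gamma,t)$: for each application occurrence in $t$ take three elements $f,a,c$ (function, argument, continuation) with $v(f)=c$, $v(c)=a$, $v(a)=f$; for each abstraction occurrence take three elements $\rho,\pi,\beta$ (root, parameter, body) with $v(\rho)=\pi$, $v(\pi)=\beta$, $v(\beta)=\rho$; add one extra element $r$ with $v(r)=r$. Each subterm occurrence $s$ of $t$ has a receiving element: $r$ if $s$ is $t$ itself, the function (resp. argument) element of the application $s'(s'')$ if $s$ is $s'$ (resp. $s''$), and the body element of $\lambda x[s]$ if $s$ is its body. Each subterm occurrence other than an occurrence of a free variable has a producing element: the continuation element if $s$ is an application, the root element if $s$ is an abstraction, the parameter element of the abstraction binding $x$ if $s$ is an occurrence of a bound variable $x$. Then $e$ swaps the producing and receiving elements of each such occurrence and fixes the receiving element of each free-variable occurrence. The root is $r$ and the boundary is $(y_1,\dots,y_k)$ with $y_i$ the receiving element of the occurrence of $x_i$. *)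

theory Defs
  imports "HOL-Algebra.Group_Action" "HOL-Library.Sublist"
begin

section \<open>Linear lambda terms\<close>

datatype trm = Var nat | App trm trm | Lam nat trm

text \<open>Contexts are lists, extended on the right as in \<open>\<Gamma>, x\<close>. The rules only derive
  judgments whose context is distinct, see \<open>linear_distinct\<close> below.\<close>

inductive linear :: "nat list \<Rightarrow> trm \<Rightarrow> bool" where
  var: "linear [x] (Var x)"
| app: "linear \<Gamma> t \<Longrightarrow> linear \<Delta> u \<Longrightarrow> set \<Gamma> \<inter> set \<Delta> = {} \<Longrightarrow> linear (\<Gamma> @ \<Delta>) (App t u)"
| lam: "linear (\<Gamma> @ [x]) t \<Longrightarrow> linear \<Gamma> (Lam x t)"
| exchange: "linear (\<Gamma> @ [y, x] @ \<Delta>) t \<Longrightarrow> linear (\<Gamma> @ [x, y] @ \<Delta>) t"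

lemma linear_distinct: "linear \<Gamma> t \<Longrightarrow> distinct \<Gamma>"
  by (induction rule: linear.induct) auto

fun apps :: "trm \<Rightarrow> nat" where
  "apps (Var x) = 0"
| "apps (App t u) = Suc (apps t + apps u)"
| "apps (Lam x t) = apps t"

fun lams :: "trm \<Rightarrow> nat" where
  "lams (Var x) = 0"
| "lams (App t u) = lams t + lams u"
| "lams (Lam x t) = Suc (lams t)"

text \<open>All names used in a term: free, bound or binding.\<close>

fun vars :: "trm \<Rightarrow> nat set" where
  "vars (Var x) = {x}"
| "vars (App t u) = vars t \<union> vars u"
| "vars (Lam x t) = insert x (vars t)"

text \<open>\<open>rename x y t\<close> is \<open>t{y/x}\<close>, replacing the free occurrences of \<open>x\<close>. It is only used
  with \<open>y \<notin> vars t\<close>, so that no capture can occur.\<close>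

fun rename :: "nat \<Rightarrow> nat \<Rightarrow> trm \<Rightarrow> trm" where
  "rename x y (Var z) = Var (if z = x then y else z)"
| "rename x y (App t u) = App (rename x y t) (rename x y u)"
| "rename x y (Lam z t) = Lam z (if z = x then t else rename x y t)"

inductive bound_change :: "trm \<Rightarrow> trm \<Rightarrow> bool" where
  here: "y \<notin> vars u \<Longrightarrow> bound_change (Lam x u) (Lam y (rename x y u))"
| app_fun: "bound_change t t' \<Longrightarrow> bound_change (App t u) (App t' u)"
| app_arg: "bound_change u u' \<Longrightarrow> bound_change (App t u) (App t u')"
| lam_body: "bound_change t t' \<Longrightarrow> bound_change (Lam x t) (Lam x t')"

inductive alpha_step :: "nat list \<times> trm \<Rightarrow> nat list \<times> trm \<Rightarrow> bool" where
  free: "linear (\<Gamma> @ x # \<Delta>) t \<Longrightarrow> y \<notin> set (\<Gamma> @ \<Delta>) \<union> vars t \<Longrightarrow>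
    alpha_step (\<Gamma> @ x # \<Delta>, t) (\<Gamma> @ y # \<Delta>, rename x y t)"
| bound: "linear \<Gamma> t \<Longrightarrow> bound_change t t' \<Longrightarrow> alpha_step (\<Gamma>, t) (\<Gamma>, t')"

definition alpha_equiv :: "nat list \<times> trm \<Rightarrow> nat list \<times> trm \<Rightarrow> bool" where
  "alpha_equiv = equivclp alpha_step"


section \<open>Groups given by generators and relators\<close>

text \<open>In a word, \<open>(g, True)\<close> stands for the generator \<open>g\<close> and \<open>(g, False)\<close> for its
  inverse. The group presented by a set of relators has as elements the classes of words
  modulo insertion and deletion of \<open>g g\<inverse>\<close>, \<open>g\<inverse> g\<close> and relators.\<close>

type_synonym 'g word = "('g \<times> bool) list"

inductive word_step :: "'g word set \<Rightarrow> 'g word \<Rightarrow> 'g word \<Rightarrow> bool" for R where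
  cancel: "word_step R (u @ [(g, b), (g, \<not> b)] @ w) (u @ w)"
| relator: "r \<in> R \<Longrightarrow> word_step R (u @ r @ w) (u @ w)"

definition word_class :: "'g word set \<Rightarrow> 'g word \<Rightarrow> 'g word set" where
  "word_class R u = {w. equivclp (word_step R) u w}"

definition presented_group :: "'g word set \<Rightarrow> 'g word set monoid" where
  "presented_group R =
    \<lparr>carrier = range (word_class R),
     mult = \<lambda>A B. \<Union>a\<in>A. \<Union>b\<in>B. word_class R (a @ b),
     one = word_class R []\<rparr>"

lemma word_class_eq_iff: "word_class R u = word_class R w \<longleftrightarrow> equivclp (word_step R) u w"
  unfolding word_class_def set_eq_iff mem_Collect_eq
  by (metis equivclp_refl equivclp_sym equivclp_trans)

lemma word_step_context: "word_step R u w \<Longrightarrow> word_step R (a @ u @ b) (a @ w @ b)"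
proof (induction rule: word_step.induct)
  case (cancel u g s w)
  show ?case using word_step.cancel[of R "a @ u" g s "w @ b"] by simp
next
  case (relator r u w)
  then show ?case using word_step.relator[of r R "a @ u" "w @ b"] by simp
qed

lemma word_equiv_context:
  "equivclp (word_step R) u w \<Longrightarrow> equivclp (word_step R) (a @ u @ b) (a @ w @ b)"
proof (induction rule: equivclp_induct)
  case base
  show ?case by simp
next
  case (step y z)
  then have "word_step R (a @ y @ b) (a @ z @ b) \<or> word_step R (a @ z @ b) (a @ y @ b)"
    using word_step_context by blast
  then have "equivclp (word_step R) (a @ y @ b) (a @ z @ b)"
    using r_into_equivclp equivclp_sym by metis
  with step.IH show ?case by (rule equivclp_trans)
qed

lemma word_equiv_append:
  assumes "equivclp (word_step R) a a'" and "equivclp (word_step R) b b'"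
  shows "equivclp (word_step R) (a @ b) (a' @ b')"
proof -
  have "equivclp (word_step R) (a @ b) (a' @ b)"
    using word_equiv_context[OF assms(1), of "[]" b] by simp
  also have "equivclp (word_step R) (a' @ b) (a' @ b')"
    using word_equiv_context[OF assms(2), of a' "[]"] by simp
  finally (equivclp_trans) show ?thesis .
qed

lemma presented_group_mult:
  "word_class R a \<otimes>\<^bsub>presented_group R\<^esub> word_class R b = word_class R (a @ b)"
proof -
  have classes: "word_class R (a' @ b') = word_class R (a @ b)"
    if "a' \<in> word_class R a" "b' \<in> word_class R b" for a' b'
  proof -
    have "equivclp (word_step R) (a @ b) (a' @ b')"
      using that by (intro word_equiv_append) (simp_all add: word_class_def)
    then show ?thesis by (simp only: word_class_eq_iff[symmetric])
  qed
  have "a \<in> word_class R a" "b \<in> word_class R b"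
    by (simp_all add: word_class_def)
  with classes have "(\<Union>a'\<in>word_class R a. \<Union>b'\<in>word_class R b. word_class R (a' @ b'))
      = word_class R (a @ b)"
    by blast
  then show ?thesis by (simp add: presented_group_def)
qed

definition word_inv :: "'g word \<Rightarrow> 'g word" where
  "word_inv w = rev (map (\<lambda>(g, b). (g, \<not> b)) w)"

lemma word_inv_left: "equivclp (word_step R) (word_inv w @ w) []"
proof (induction w)
  case Nil
  show ?case by (simp add: word_inv_def)
next
  case (Cons x w)
  obtain g b where x: "x = (g, b)" by (cases x)
  have "word_step R (word_inv w @ [(g, \<not> b), (g, \<not> \<not> b)] @ w) (word_inv w @ w)"
    by (rule word_step.cancel)
  then have "equivclp (word_step R) (word_inv (x # w) @ x # w) (word_inv w @ w)"
    by (auto simp: word_inv_def x)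
  from this Cons.IH show ?case by (rule equivclp_trans)
qed

lemma group_presented_group: "group (presented_group R)"
proof (rule groupI)
  fix x assume "x \<in> carrier (presented_group R)"
  then obtain w where x: "x = word_class R w" by (auto simp: presented_group_def)
  show "\<exists>y\<in>carrier (presented_group R). y \<otimes>\<^bsub>presented_group R\<^esub> x = \<one>\<^bsub>presented_group R\<^esub>"
  proof
    show "word_class R (word_inv w) \<in> carrier (presented_group R)"
      by (simp add: presented_group_def)
    show "word_class R (word_inv w) \<otimes>\<^bsub>presented_group R\<^esub> x = \<one>\<^bsub>presented_group R\<^esub>"
      unfolding x presented_group_mult
      by (simp add: presented_group_def word_class_eq_iff word_inv_left)
  qed
next
  fix x assume "x \<in> carrier (presented_group R)"
  then obtain w where x: "x = word_class R w" by (auto simp: presented_group_def)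
  have "\<one>\<^bsub>presented_group R\<^esub> = word_class R []" by (simp add: presented_group_def)
  then show "\<one>\<^bsub>presented_group R\<^esub> \<otimes>\<^bsub>presented_group R\<^esub> x = x"
    by (simp add: x presented_group_mult)
next
  fix x y assume "x \<in> carrier (presented_group R)" "y \<in> carrier (presented_group R)"
  then obtain u w where "x = word_class R u" "y = word_class R w"
    by (auto simp: presented_group_def)
  then show "x \<otimes>\<^bsub>presented_group R\<^esub> y \<in> carrier (presented_group R)"
    by (simp add: presented_group_mult) (simp add: presented_group_def)
next
  fix x y z
  assume "x \<in> carrier (presented_group R)" "y \<in> carrier (presented_group R)"
    "z \<in> carrier (presented_group R)"
  then obtain u w s where "x = word_class R u" "y = word_class R w" "z = word_class R s"
    by (auto simp: presented_group_def)
  then show "x \<otimes>\<^bsub>presented_group R\<^esub> y \<otimes>\<^bsub>presented_group R\<^esub> z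
      = x \<otimes>\<^bsub>presented_group R\<^esub> (y \<otimes>\<^bsub>presented_group R\<^esub> z)"
    by (simp add: presented_group_mult)
qed (simp add: presented_group_def)

datatype gen = gen_v | gen_e

definition T_relators :: "gen word set" where
  "T_relators = {replicate 3 (gen_v, True), replicate 2 (gen_e, True)}"

definition T_group :: "gen word set monoid" where
  "T_group = presented_group T_relators"

definition T_gen :: "gen \<Rightarrow> gen word set" where
  "T_gen g = word_class T_relators [(g, True)]"


section \<open>Rooted trivalent maps with boundary\<close>

text \<open>An action of \<open>T_group\<close> is recorded by the actions \<open>vmap\<close> and \<open>emap\<close> of the two
  generators, of which only the restrictions to the carrier matter.\<close>

record 'a rtmap = "'a partial_object" +
  vmap :: "'a \<Rightarrow> 'a"
  emap :: "'a \<Rightarrow> 'a"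
  root_elt :: 'a
  boundary :: "'a list"

definition transitive_T_set :: "('a, 'b) rtmap_scheme \<Rightarrow> bool" where
  "transitive_T_set M \<longleftrightarrow>
    (\<exists>\<phi>. transitive_action T_group (carrier M) \<phi> \<and>
      (\<forall>x\<in>carrier M. vmap M x = \<phi> (T_gen gen_v) x \<and> emap M x = \<phi> (T_gen gen_e) x))"

text \<open>\<open>T_group\<close>-sets are the same as sets with bijections \<open>v\<close>, \<open>e\<close> satisfying
  \<open>v\<^sup>3 = e\<^sup>2 = 1\<close>; transitivity can be tested with positive words.\<close>

inductive reachable :: "('a, 'b) rtmap_scheme \<Rightarrow> 'a \<Rightarrow> 'a \<Rightarrow> bool" for M where
  refl: "reachable M x x"
| vmap: "reachable M x y \<Longrightarrow> reachable M x (vmap M y)"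
| emap: "reachable M x y \<Longrightarrow> reachable M x (emap M y)"

fun letter_act :: "('a, 'b) rtmap_scheme \<Rightarrow> gen \<times> bool \<Rightarrow> 'a \<Rightarrow> 'a" where
  "letter_act M (gen_v, True) x = vmap M x"
| "letter_act M (gen_v, False) x = vmap M (vmap M x)"
| "letter_act M (gen_e, b) x = emap M x"

definition word_act :: "('a, 'b) rtmap_scheme \<Rightarrow> gen word \<Rightarrow> 'a \<Rightarrow> 'a" where
  "word_act M w x = foldr (letter_act M) w x"

lemma transitive_T_setI:
  assumes v: "vmap M \<in> carrier M \<rightarrow> carrier M" "\<And>x. x \<in> carrier M \<Longrightarrow> vmap M (vmap M (vmap M x)) = x"
    and e: "emap M \<in> carrier M \<rightarrow> carrier M" "\<And>x. x \<in> carrier M \<Longrightarrow> emap M (emap M x) = x"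
    and reach: "\<And>x y. x \<in> carrier M \<Longrightarrow> y \<in> carrier M \<Longrightarrow> reachable M x y"
  shows "transitive_T_set M"
proof -
  let ?C = "carrier M" and ?A = "word_act M"
  have letter: "letter_act M l x \<in> ?C" if "x \<in> ?C" for l x
    using that v(1) e(1) by (cases "(M, l, x)" rule: letter_act.cases) auto
  have closed: "?A w x \<in> ?C" if "x \<in> ?C" for w x
    using that by (induction w) (auto simp: word_act_def letter)
  have append: "?A (u @ w) x = ?A u (?A w x)" for u w x
    by (simp add: word_act_def)
  have pair: "?A [(g, b), (g, \<not> b)] x = x" if "x \<in> ?C" for g b x
    using that v e by (cases g; cases b) (auto simp: word_act_def)
  have rel: "?A r x = x" if "x \<in> ?C" "r \<in> T_relators" for r x
    using that v e by (auto simp: word_act_def T_relators_def numeral_3_eq_3 numeral_2_eq_2)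
  have step: "?A u x = ?A w x" if "word_step T_relators u w" "x \<in> ?C" for u w x
    using that
  proof cases
    case (cancel a g b c)
    then show ?thesis using pair closed that(2) unfolding cancel append by simp
  next
    case (relator r a c)
    then show ?thesis using rel closed that(2) unfolding append relator by simp
  qed
  have equiv: "?A u x = ?A w x" if "equivclp (word_step T_relators) u w" "x \<in> ?C" for u w x
    using that
  proof (induction rule: equivclp_induct)
    case (step y z)
    then show ?case using \<open>\<And>u w x. \<lbrakk>word_step T_relators u w; x \<in> ?C\<rbrakk> \<Longrightarrow> ?A u x = ?A w x\<close> by metis
  qed simp
  define \<phi> where "\<phi> X = restrict (?A (SOME w. w \<in> X)) ?C" for X
  have \<phi>: "\<phi> (word_class T_relators w) = restrict (?A w) ?C" for w
  proof -
    have "w \<in> word_class T_relators w" by (simp add: word_class_def)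
    then have "(SOME u. u \<in> word_class T_relators w) \<in> word_class T_relators w"
      by (rule someI)
    then have "equivclp (word_step T_relators) w (SOME u. u \<in> word_class T_relators w)"
      by (simp add: word_class_def)
    from equiv[OF this] show ?thesis by (auto simp: \<phi>_def fun_eq_iff restrict_def)
  qed
  have inv: "?A (word_inv w) (?A w x) = x" if "x \<in> ?C" for w x
    using equiv[OF word_inv_left that, of w] by (simp add: append word_act_def)
  have inv_inv: "word_inv (word_inv w) = w" for w :: "gen word"
    by (induction w) (auto simp: word_inv_def)
  have bij: "restrict (?A w) ?C \<in> Bij ?C" for w
  proof -
    have "bij_betw (?A w) ?C ?C"
      by (rule bij_betw_byWitness[where f' = "?A (word_inv w)"])
        (use inv inv[of _ "word_inv w"] closed in \<open>auto simp: inv_inv\<close>)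
    then show ?thesis by (simp add: Bij_def)
  qed
  have car: "carrier T_group = range (word_class T_relators)"
    by (simp add: T_group_def presented_group_def)
  have "group_hom T_group (BijGroup ?C) \<phi>"
  proof (intro group_hom.intro group_hom_axioms.intro)
    show "group T_group" by (simp add: T_group_def group_presented_group)
    show "group (BijGroup ?C)" by (rule group_BijGroup)
    show "\<phi> \<in> hom T_group (BijGroup ?C)"
    proof (rule homI)
      fix X assume "X \<in> carrier T_group"
      then show "\<phi> X \<in> carrier (BijGroup ?C)" using bij by (auto simp: car \<phi> BijGroup_def)
    next
      fix X Y assume "X \<in> carrier T_group" "Y \<in> carrier T_group"
      then obtain u w where XY: "X = word_class T_relators u" "Y = word_class T_relators w"
        by (auto simp: car)
      have "\<phi> (X \<otimes>\<^bsub>T_group\<^esub> Y) = restrict (?A (u @ w)) ?C"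
        by (simp add: XY T_group_def presented_group_mult \<phi>)
      also have "\<dots> = compose ?C (restrict (?A u) ?C) (restrict (?A w) ?C)"
        using closed by (auto simp: compose_def append fun_eq_iff restrict_def)
      finally show "\<phi> (X \<otimes>\<^bsub>T_group\<^esub> Y) = \<phi> X \<otimes>\<^bsub>BijGroup ?C\<^esub> \<phi> Y"
        using bij by (simp add: BijGroup_def XY \<phi>)
    qed
  qed
  moreover have "\<exists>g\<in>carrier T_group. \<phi> g x = y" if xy: "x \<in> ?C" "y \<in> ?C" for x y
  proof -
    have "\<exists>w. y = ?A w x" using reach[OF xy]
    proof (induction rule: reachable.induct)
      case (refl x)
      show ?case by (rule exI[of _ "[]"]) (simp add: word_act_def)
    next
      case (vmap x y)
      then obtain w where "y = ?A w x" by blast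
      then show ?case by (intro exI[of _ "(gen_v, True) # w"]) (simp add: word_act_def)
    next
      case (emap x y)
      then obtain w where "y = ?A w x" by blast
      then show ?case by (intro exI[of _ "(gen_e, True) # w"]) (simp add: word_act_def)
    qed
    then show ?thesis using xy by (auto simp: car \<phi>)
  qed
  ultimately have "transitive_action T_group ?C \<phi>"
    by (intro transitive_action.intro group_action.intro transitive_action_axioms.intro)
  then show ?thesis unfolding transitive_T_set_def
    by (intro exI[of _ \<phi>]) (auto simp: T_gen_def \<phi> word_act_def)
qed

lemma transitive_T_setD:
  assumes "transitive_T_set M"
  shows "vmap M \<in> carrier M \<rightarrow> carrier M"
    and "\<And>x. x \<in> carrier M \<Longrightarrow> vmap M (vmap M (vmap M x)) = x"
    and "emap M \<in> carrier M \<rightarrow> carrier M"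
    and "\<And>x. x \<in> carrier M \<Longrightarrow> emap M (emap M x) = x"
    and "\<And>x y. x \<in> carrier M \<Longrightarrow> y \<in> carrier M \<Longrightarrow> reachable M x y"
proof -
  let ?C = "carrier M" and ?W = "word_class T_relators"
  obtain \<phi> where act: "transitive_action T_group ?C \<phi>"
    and v: "\<And>x. x \<in> ?C \<Longrightarrow> vmap M x = \<phi> (?W [(gen_v, True)]) x"
    and e: "\<And>x. x \<in> ?C \<Longrightarrow> emap M x = \<phi> (?W [(gen_e, True)]) x"
    using assms unfolding transitive_T_set_def T_gen_def by blast
  interpret transitive_action T_group ?C \<phi> by (rule act)
  have car: "?W w \<in> carrier T_group" for w
    by (simp add: T_group_def presented_group_def)
  have closed: "\<phi> (?W w) x \<in> ?C" if "x \<in> ?C" for w x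
    using surj_prop[OF car, of w] that by blast
  have append: "\<phi> (?W u) (\<phi> (?W w) x) = \<phi> (?W (u @ w)) x" if "x \<in> ?C" for u w x
    using composition_rule[OF that car car, of u w]
    by (simp add: T_group_def presented_group_mult)
  have one: "\<phi> (?W w) x = x" if "x \<in> ?C" "?W w = ?W []" for w x
  proof -
    have "?W [] = \<one>\<^bsub>T_group\<^esub>" by (simp add: T_group_def presented_group_def)
    then show ?thesis using that id_eq_one by (metis restrict_apply')
  qed
  have rel: "?W r = ?W []" if "r \<in> T_relators" for r
    using word_step.relator[OF that, of "[]" "[]"] by (auto simp: word_class_eq_iff)
  have v3: "?W [(gen_v, True), (gen_v, True), (gen_v, True)] = ?W []"
    using rel[of "replicate 3 (gen_v, True)"] by (simp add: T_relators_def numeral_3_eq_3)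
  have e2: "?W [(gen_e, True), (gen_e, True)] = ?W []"
    using rel[of "replicate 2 (gen_e, True)"] by (simp add: T_relators_def numeral_2_eq_2)
  show vC: "vmap M \<in> ?C \<rightarrow> ?C" and eC: "emap M \<in> ?C \<rightarrow> ?C"
    using closed v e by auto
  show vvv: "vmap M (vmap M (vmap M x)) = x" if "x \<in> ?C" for x
    using that one[OF _ v3] by (simp add: v closed append)
  show ee: "emap M (emap M x) = x" if "x \<in> ?C" for x
    using that one[OF _ e2] by (simp add: e closed append)
  have v_inv: "\<phi> (?W [(gen_v, False)]) x = vmap M (vmap M x)" if "x \<in> ?C" for x
  proof -
    have "word_step T_relators [(gen_v, False), (gen_v, True)] []"
      using word_step.cancel[of T_relators "[]" gen_v False "[]"] by simp
    then have "?W [(gen_v, False), (gen_v, True)] = ?W []"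
      by (auto simp: word_class_eq_iff)
    then have "\<phi> (?W [(gen_v, False)]) (vmap M y) = y" if "y \<in> ?C" for y
      using that one[of y] by (simp add: v append)
    from this[of "vmap M (vmap M x)"] show ?thesis using that vvv vC by auto
  qed
  have e_inv: "\<phi> (?W [(gen_e, False)]) x = emap M x" if "x \<in> ?C" for x
  proof -
    have "word_step T_relators [(gen_e, False), (gen_e, True)] []"
      using word_step.cancel[of T_relators "[]" gen_e False "[]"] by simp
    then have "?W [(gen_e, False), (gen_e, True)] = ?W []"
      by (auto simp: word_class_eq_iff)
    then have "\<phi> (?W [(gen_e, False)]) (emap M y) = y" if "y \<in> ?C" for y
      using that one[of y] by (simp add: e append)
    from this[of "emap M x"] show ?thesis using that ee eC by auto
  qed
  have reach: "reachable M x (\<phi> (?W w) x)" if "x \<in> ?C" for w x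
  proof (induction w)
    case Nil
    show ?case using one[OF that, of "[]"] by (simp add: reachable.refl)
  next
    case (Cons l w)
    obtain g b where l: "l = (g, b)" by (cases l)
    have "\<phi> (?W (l # w)) x = \<phi> (?W [l]) (\<phi> (?W w) x)"
      using append[OF that, of "[l]" w] by simp
    then show ?case using Cons.IH closed[OF that, of w]
      by (cases g; cases b)
        (auto simp: l v_inv e_inv v[symmetric] e[symmetric]
          intro: reachable.vmap reachable.emap)
  qed
  show "reachable M x y" if "x \<in> ?C" "y \<in> ?C" for x y
  proof -
    have "\<exists>g\<in>carrier T_group. \<phi> g x = y" using that by (rule unique_orbit)
    then have "\<exists>w. \<phi> (?W w) x = y" by (auto simp: T_group_def presented_group_def)
    then show ?thesis using reach[OF that(1)] by blast
  qed
qed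

definition rooted_trivalent_map :: "('a, 'b) rtmap_scheme \<Rightarrow> bool" where
  "rooted_trivalent_map M \<longleftrightarrow>
    transitive_T_set M \<and>
    {x \<in> carrier M. vmap M x = x} = {root_elt M} \<and>
    distinct (boundary M) \<and>
    {x \<in> carrier M. emap M x = x} = set (boundary M)"

definition degree :: "('a, 'b) rtmap_scheme \<Rightarrow> nat" where
  "degree M = length (boundary M)"

definition trivalent_vertices :: "('a, 'b) rtmap_scheme \<Rightarrow> 'a set set" where
  "trivalent_vertices M =
    {V. \<exists>x\<in>carrier M. V = range (\<lambda>i. (vmap M ^^ i) x) \<and> card V = 3}"

definition rtmap_iso ::
  "('a, 'c) rtmap_scheme \<Rightarrow> ('b, 'd) rtmap_scheme \<Rightarrow> ('a \<Rightarrow> 'b) \<Rightarrow> bool" where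
  "rtmap_iso M N f \<longleftrightarrow>
    bij_betw f (carrier M) (carrier N) \<and>
    (\<forall>x\<in>carrier M. f (vmap M x) = vmap N (f x) \<and> f (emap M x) = emap N (f x)) \<and>
    f (root_elt M) = root_elt N \<and>
    map f (boundary M) = boundary N"

definition rtmap_isomorphic :: "('a, 'c) rtmap_scheme \<Rightarrow> ('b, 'd) rtmap_scheme \<Rightarrow> bool" where
  "rtmap_isomorphic M N \<longleftrightarrow> (\<exists>f. rtmap_iso M N f)"


section \<open>The underlying rooted trivalent map of a linear lambda term\<close>

text \<open>Subterm occurrences are represented by their paths from the root of the term.\<close>

datatype dir = Fun_dir | Arg_dir | Body_dir

type_synonym path = "dir list"

fun subterm_at :: "trm \<Rightarrow> path \<Rightarrow> trm option" where
  "subterm_at t [] = Some t"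
| "subterm_at (App t u) (Fun_dir # p) = subterm_at t p"
| "subterm_at (App t u) (Arg_dir # p) = subterm_at u p"
| "subterm_at (Lam x t) (Body_dir # p) = subterm_at t p"
| "subterm_at t (d # p) = None"

definition is_app_at :: "trm \<Rightarrow> path \<Rightarrow> bool" where
  "is_app_at t p \<longleftrightarrow> (\<exists>u w. subterm_at t p = Some (App u w))"

definition is_lam_at :: "trm \<Rightarrow> path \<Rightarrow> bool" where
  "is_lam_at t p \<longleftrightarrow> (\<exists>x u. subterm_at t p = Some (Lam x u))"

text \<open>\<open>binds t q x p\<close>: the occurrence of \<open>x\<close> at \<open>p\<close> is bound by the abstraction at \<open>q\<close>,
  the innermost one around \<open>p\<close> that abstracts \<open>x\<close>.\<close>

definition binds :: "trm \<Rightarrow> path \<Rightarrow> nat \<Rightarrow> path \<Rightarrow> bool" where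
  "binds t q x p \<longleftrightarrow>
    subterm_at t p = Some (Var x) \<and>
    strict_prefix q p \<and> (\<exists>u. subterm_at t q = Some (Lam x u)) \<and>
    (\<forall>q' u. strict_prefix q q' \<and> strict_prefix q' p \<longrightarrow> subterm_at t q' \<noteq> Some (Lam x u))"

definition free_at :: "trm \<Rightarrow> nat \<Rightarrow> path \<Rightarrow> bool" where
  "free_at t x p \<longleftrightarrow> subterm_at t p = Some (Var x) \<and> (\<nexists>q. binds t q x p)"

datatype elt =
    Root_elt
  | Fun_elt path | Arg_elt path | Cont_elt path
  | Lam_elt path | Param_elt path | Body_elt path

definition elts :: "trm \<Rightarrow> elt set" where
  "elts t = {Root_elt}
    \<union> (\<Union>p \<in> {p. is_app_at t p}. {Fun_elt p, Arg_elt p, Cont_elt p})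
    \<union> (\<Union>p \<in> {p. is_lam_at t p}. {Lam_elt p, Param_elt p, Body_elt p})"

fun term_vmap :: "elt \<Rightarrow> elt" where
  "term_vmap Root_elt = Root_elt"
| "term_vmap (Fun_elt p) = Cont_elt p"
| "term_vmap (Cont_elt p) = Arg_elt p"
| "term_vmap (Arg_elt p) = Fun_elt p"
| "term_vmap (Lam_elt p) = Param_elt p"
| "term_vmap (Param_elt p) = Body_elt p"
| "term_vmap (Body_elt p) = Lam_elt p"

definition receiver :: "path \<Rightarrow> elt" where
  "receiver p = (if p = [] then Root_elt else
    (case last p of
      Fun_dir \<Rightarrow> Fun_elt (butlast p)
    | Arg_dir \<Rightarrow> Arg_elt (butlast p)
    | Body_dir \<Rightarrow> Body_elt (butlast p)))"

text \<open>\<open>produces t p z\<close>: the subterm occurrence at \<open>p\<close> has producing element \<open>z\<close>.\<close>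

inductive produces :: "trm \<Rightarrow> path \<Rightarrow> elt \<Rightarrow> bool" for t where
  app: "is_app_at t p \<Longrightarrow> produces t p (Cont_elt p)"
| lam: "is_lam_at t p \<Longrightarrow> produces t p (Lam_elt p)"
| var: "binds t q x p \<Longrightarrow> produces t p (Param_elt q)"

text \<open>In a linear term every parameter element is produced by exactly one occurrence, so
  there is at most one partner \<open>z'\<close> for each \<open>z\<close>. The elements without partner are the
  receiving elements of the occurrences of free variables.\<close>

definition swapped :: "trm \<Rightarrow> elt \<Rightarrow> elt \<Rightarrow> bool" where
  "swapped t z z' \<longleftrightarrow>
    (\<exists>p. produces t p z \<and> z' = receiver p \<or> produces t p z' \<and> z = receiver p)"

definition term_emap :: "trm \<Rightarrow> elt \<Rightarrow> elt" where
  "term_emap t z = (if \<exists>z'. swapped t z z' then THE z'. swapped t z z' else z)"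

definition underlying_map :: "nat list \<Rightarrow> trm \<Rightarrow> elt rtmap" where
  "underlying_map \<Gamma> t =
    \<lparr>carrier = elts t,
     vmap = term_vmap,
     emap = term_emap t,
     root_elt = Root_elt,
     boundary = map (\<lambda>x. receiver (THE p. free_at t x p)) \<Gamma>\<rparr>"

end

theory Submission
  imports Defs
begin

text \<open>
  Walking down from the root, every vertex \<open>{z, v z, v (v z)}\<close> is entered through a unique element
  \<open>z\<close>. Cut it apart: if this separates \<open>v z\<close> from \<open>v (v z)\<close>, the vertex must be an application and
  the two components are its argument and function; otherwise it must be an abstraction whose
  parameter is an extra loose end of the component of its body. Induction on the number of elements
  not yet cut gives the term. Its map is isomorphic to the given one because the place of every
  occurrence in the given map can be read off its path, and the names of the variables are names
  for elements of the given map.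

  For uniqueness, rename all variables of a term by fresh names of the elements that its parameters
  and free variables occupy in the given map. The resulting term depends only on the map.
\<close>

section \<open>Linearity and renaming\<close>

text \<open>Locally a map does not tell applications from abstractions: a vertex entered through
  \<open>z\<close> has its other ends at \<open>v z\<close> (argument or parameter) and
  \<open>v (v z)\<close> (function or body). Only linearity breaks the tie. The two parts of an
  application share no variable, so nothing but the vertex joins them, whereas the occurrence of a
  bound variable joins parameter and body.

  Terms and maps are compared through two predicates recursive in the term. The only possible
  equivariant map from a term, once the root is matched, is \<open>place\<close>.
  \<open>decodes\<close> expresses that it respects the edges, and \<open>fresh\<close> that no
  vertex recurs below itself and the root is not met again. With the boundary condition on \<rho>
  they amount to an isomorphism (\<open>decodes_iso\<close>, \<open>iso_decodes\<close>), so
  existence and uniqueness need no further talk of bijections.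

  Finiteness of the carrier bounds the cutting, and it lets the elements be named by numbers outside
  a given finite set of variables.\<close>

fun fv :: "trm \<Rightarrow> nat set" where
  "fv (Var x) = {x}"
| "fv (App t u) = fv t \<union> fv u"
| "fv (Lam x t) = fv t - {x}"

text \<open>Linearity without a context: disjointness at applications allows at most one free
  occurrence of a name, membership at abstractions demands at least one. No exchange rule then
  disturbs structural induction.\<close>

fun uses_once :: "trm \<Rightarrow> bool" where
  "uses_once (Var x) \<longleftrightarrow> True"
| "uses_once (App t u) \<longleftrightarrow> uses_once t \<and> uses_once u \<and> fv t \<inter> fv u = {}"
| "uses_once (Lam x t) \<longleftrightarrow> uses_once t \<and> x \<in> fv t"

lemma fv_subset_vars: "fv t \<subseteq> vars t"
  by (induction t) auto

lemma finite_fv: "finite (fv t)"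
  by (induction t) auto

lemma finite_vars: "finite (vars t)"
  by (induction t) auto

lemma linear_move: "linear (\<Gamma> @ x # \<Delta> @ \<Phi>) t \<Longrightarrow> linear (\<Gamma> @ \<Delta> @ x # \<Phi>) t"
proof (induction \<Delta> arbitrary: \<Gamma>)
  case (Cons y \<Delta>)
  then have "linear (\<Gamma> @ [x, y] @ \<Delta> @ \<Phi>) t" by simp
  then have "linear (\<Gamma> @ [y, x] @ \<Delta> @ \<Phi>) t" by (rule linear.exchange)
  then show ?case using Cons.IH[of "\<Gamma> @ [y]"] by simp
qed simp

text \<open>The target order is built from its right end: adjacent exchanges carry the last wanted
  variable to the front of the finished suffix \<open>\<Phi>\<close>.\<close>

lemma linear_permute:
  "linear (\<Gamma> @ \<Phi>) t \<Longrightarrow> distinct \<Gamma> \<Longrightarrow> distinct \<Delta> \<Longrightarrow> set \<Delta> = set \<Gamma> \<Longrightarrow> linear (\<Delta> @ \<Phi>) t"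
proof (induction \<Delta> arbitrary: \<Gamma> \<Phi> rule: rev_induct)
  case (snoc x \<Delta>)
  then obtain \<Gamma>1 \<Gamma>2 where G: "\<Gamma> = \<Gamma>1 @ x # \<Gamma>2"
    by (metis in_set_conv_decomp in_set_conv_decomp_first set_append Un_iff list.set_intros(1))
  have "linear ((\<Gamma>1 @ \<Gamma>2) @ x # \<Phi>) t"
    using linear_move[of \<Gamma>1 x \<Gamma>2 \<Phi> t] snoc.prems(1) by (simp add: G)
  then have "linear (\<Delta> @ x # \<Phi>) t"
    using snoc.prems by (intro snoc.IH[of "\<Gamma>1 @ \<Gamma>2"]) (auto simp: G)
  then show ?case by simp
qed auto

lemma linear_iff: "linear \<Gamma> t \<longleftrightarrow> distinct \<Gamma> \<and> set \<Gamma> = fv t \<and> uses_once t"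
proof
  assume "linear \<Gamma> t"
  then show "distinct \<Gamma> \<and> set \<Gamma> = fv t \<and> uses_once t"
    by (induction rule: linear.induct) auto
next
  show "distinct \<Gamma> \<and> set \<Gamma> = fv t \<and> uses_once t \<Longrightarrow> linear \<Gamma> t"
  proof (induction t arbitrary: \<Gamma>)
    case (Var x)
    then have "\<Gamma> = [x]" by (cases \<Gamma>; cases "tl \<Gamma>") auto
    then show ?case by (simp add: linear.var)
  next
    case (App t u)
    obtain \<Gamma>1 \<Gamma>2 where G: "set \<Gamma>1 = fv t" "distinct \<Gamma>1" "set \<Gamma>2 = fv u" "distinct \<Gamma>2"
      using finite_distinct_list finite_fv by metis
    then have "linear (\<Gamma>1 @ \<Gamma>2) (App t u)"
      using App.prems by (intro linear.app[OF App.IH]) auto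
    then show ?case
      using linear_permute[of "\<Gamma>1 @ \<Gamma>2" "[]" "App t u" \<Gamma>] App.prems G by auto
  next
    case (Lam x t)
    then have "linear (\<Gamma> @ [x]) t" by (intro Lam.IH) auto
    then show ?case by (rule linear.lam)
  qed
qed

lemma fv_rename: "y \<notin> vars t \<Longrightarrow> fv (rename x y t) = (if x \<in> fv t then insert y (fv t - {x}) else fv t)"
  using fv_subset_vars by (induction t) auto

lemma vars_rename: "vars (rename x y t) \<subseteq> insert y (vars t)"
  by (induction t) auto

lemma uses_once_rename: "y \<notin> vars t \<Longrightarrow> uses_once (rename x y t) \<longleftrightarrow> uses_once t"
  using fv_subset_vars by (induction t) (auto simp: fv_rename)

lemma bound_change_fv: "bound_change t t' \<Longrightarrow> fv t' = fv t"
  by (induction rule: bound_change.induct) (use fv_subset_vars in \<open>auto simp: fv_rename\<close>)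

lemma bound_change_uses_once: "bound_change t t' \<Longrightarrow> uses_once t \<Longrightarrow> uses_once t'"
  by (induction rule: bound_change.induct) (auto simp: fv_rename uses_once_rename bound_change_fv)

lemma bound_changes_app:
  "bound_change\<^sup>*\<^sup>* t t' \<Longrightarrow> bound_change\<^sup>*\<^sup>* u u' \<Longrightarrow> bound_change\<^sup>*\<^sup>* (App t u) (App t' u')"
proof -
  assume u: "bound_change\<^sup>*\<^sup>* u u'" and t: "bound_change\<^sup>*\<^sup>* t t'"
  from t have "bound_change\<^sup>*\<^sup>* (App t u) (App t' u)"
    by induction (auto intro: bound_change.app_fun rtranclp.rtrancl_into_rtrancl)
  also from u have "bound_change\<^sup>*\<^sup>* (App t' u) (App t' u')"
    by induction (auto intro: bound_change.app_arg rtranclp.rtrancl_into_rtrancl)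
  finally show ?thesis .
qed

lemma bound_changes_lam: "bound_change\<^sup>*\<^sup>* t t' \<Longrightarrow> bound_change\<^sup>*\<^sup>* (Lam x t) (Lam x t')"
  by (induction rule: rtranclp_induct)
    (auto intro: bound_change.lam_body rtranclp.rtrancl_into_rtrancl)

lemma bound_change_linear: "linear \<Gamma> t \<Longrightarrow> bound_change t t' \<Longrightarrow> linear \<Gamma> t'"
  by (simp add: linear_iff bound_change_fv bound_change_uses_once)

lemma bound_changes_alpha:
  "bound_change\<^sup>*\<^sup>* t t' \<Longrightarrow> linear \<Gamma> t \<Longrightarrow> linear \<Gamma> t' \<and> alpha_equiv (\<Gamma>, t) (\<Gamma>, t')"
proof (induction rule: rtranclp_induct)
  case base
  then show ?case by (simp add: alpha_equiv_def)
next
  case (step u t')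
  then have "alpha_step (\<Gamma>, u) (\<Gamma>, t')" by (intro alpha_step.bound) auto
  then have "equivclp alpha_step (\<Gamma>, u) (\<Gamma>, t')" by (rule r_into_equivclp)
  then show ?case using step bound_change_linear unfolding alpha_equiv_def
    by (metis equivclp_trans)
qed

section \<open>Occurrences and their binders\<close>

lemma subterm_at_Var: "subterm_at (Var x) p = Some s \<longleftrightarrow> p = [] \<and> s = Var x"
  by (cases p) auto

lemma subterm_at_App: "subterm_at (App t u) p = Some s \<longleftrightarrow>
    p = [] \<and> s = App t u \<or> (\<exists>q. p = Fun_dir # q \<and> subterm_at t q = Some s) \<or>
    (\<exists>q. p = Arg_dir # q \<and> subterm_at u q = Some s)"
  by (cases "(App t u, p)" rule: subterm_at.cases) auto

lemma subterm_at_Lam: "subterm_at (Lam x t) p = Some s \<longleftrightarrow>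
    p = [] \<and> s = Lam x t \<or> (\<exists>q. p = Body_dir # q \<and> subterm_at t q = Some s)"
  by (cases "(Lam x t, p)" rule: subterm_at.cases) auto

lemmas subterm_at_simps = subterm_at_Var subterm_at_App subterm_at_Lam

lemma subterm_at_append:
  "subterm_at t (p @ q) = (case subterm_at t p of None \<Rightarrow> None | Some s \<Rightarrow> subterm_at s q)"
  by (induction t p rule: subterm_at.induct) auto

lemma is_app_at_simps:
  "\<not> is_app_at (Var x) p"
  "is_app_at (App t u) p \<longleftrightarrow> p = [] \<or> (\<exists>q. p = Fun_dir # q \<and> is_app_at t q) \<or>
    (\<exists>q. p = Arg_dir # q \<and> is_app_at u q)"
  "is_app_at (Lam x t) p \<longleftrightarrow> (\<exists>q. p = Body_dir # q \<and> is_app_at t q)"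
  by (auto simp: is_app_at_def subterm_at_simps)

lemma is_lam_at_simps:
  "\<not> is_lam_at (Var x) p"
  "is_lam_at (App t u) p \<longleftrightarrow> (\<exists>q. p = Fun_dir # q \<and> is_lam_at t q) \<or>
    (\<exists>q. p = Arg_dir # q \<and> is_lam_at u q)"
  "is_lam_at (Lam x t) p \<longleftrightarrow> p = [] \<or> (\<exists>q. p = Body_dir # q \<and> is_lam_at t q)"
  by (auto simp: is_lam_at_def subterm_at_simps)

lemma subterm_at_snoc:
  "subterm_at t (p @ [d]) \<noteq> None \<longleftrightarrow>
    is_app_at t p \<and> d \<in> {Fun_dir, Arg_dir} \<or> is_lam_at t p \<and> d = Body_dir"
proof (cases "subterm_at t p")
  case (Some s)
  then show ?thesis
    by (cases s; cases d) (auto simp: subterm_at_append is_app_at_def is_lam_at_def)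
qed (auto simp: subterm_at_append is_app_at_def is_lam_at_def)

definition abs_at :: "trm \<Rightarrow> nat \<Rightarrow> path \<Rightarrow> bool" where
  "abs_at t x p \<longleftrightarrow> (\<exists>u. subterm_at t p = Some (Lam x u))"

lemma abs_at_simps [simp]:
  "\<not> abs_at (Var y) x p"
  "\<not> abs_at (App t u) x []"
  "abs_at (App t u) x (Fun_dir # p) \<longleftrightarrow> abs_at t x p"
  "abs_at (App t u) x (Arg_dir # p) \<longleftrightarrow> abs_at u x p"
  "\<not> abs_at (App t u) x (Body_dir # p)"
  "abs_at (Lam y t) x [] \<longleftrightarrow> x = y"
  "\<not> abs_at (Lam y t) x (Fun_dir # p)"
  "\<not> abs_at (Lam y t) x (Arg_dir # p)"
  "abs_at (Lam y t) x (Body_dir # p) \<longleftrightarrow> abs_at t x p"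
  by (auto simp: abs_at_def subterm_at_simps)

lemma binds_iff: "binds t q x p \<longleftrightarrow>
    subterm_at t p = Some (Var x) \<and> strict_prefix q p \<and> abs_at t x q \<and>
    (\<forall>q'. strict_prefix q q' \<and> strict_prefix q' p \<longrightarrow> \<not> abs_at t x q')"
  by (auto simp: binds_def abs_at_def)

text \<open>If some abstraction of \<open>x\<close> encloses the occurrence, the one with the
  longest path is innermost and binds it.\<close>

lemma free_at_iff: "free_at t x p \<longleftrightarrow>
    subterm_at t p = Some (Var x) \<and> (\<forall>q. strict_prefix q p \<longrightarrow> \<not> abs_at t x q)"
proof -
  have "\<exists>q. binds t q x p"
    if t: "subterm_at t p = Some (Var x)" and q: "strict_prefix q p" "abs_at t x q" for q
  proof -
    let ?P = "\<lambda>q. strict_prefix q p \<and> abs_at t x q"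
    have "\<forall>q. ?P q \<longrightarrow> length q < length p"
      by (auto dest: prefix_length_less)
    moreover have "?P q" using q by simp
    ultimately obtain q' where q': "?P q'" "\<And>q. ?P q \<Longrightarrow> length q \<le> length q'"
      using ex_has_greatest_nat[of ?P q length "length p"] by blast
    then have "binds t q' x p"
      using t unfolding binds_iff by (meson leD prefix_length_less)
    then show ?thesis by blast
  qed
  then show ?thesis unfolding free_at_def using binds_iff by blast
qed

lemma strict_prefix_Cons_iff:
  "strict_prefix q (d # p) \<longleftrightarrow> q = [] \<or> (\<exists>q'. q = d # q' \<and> strict_prefix q' p)"
  "strict_prefix (d # p) q \<longleftrightarrow> (\<exists>q'. q = d # q' \<and> strict_prefix p q')"
  by (cases q; auto)+

lemma all_strict_prefix_Cons:
  "(\<forall>q. strict_prefix q (d # p) \<longrightarrow> P q) \<longleftrightarrow> P [] \<and> (\<forall>q. strict_prefix q p \<longrightarrow> P (d # q))"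
  unfolding strict_prefix_Cons_iff by blast

lemma all_between_Cons:
  "(\<forall>q'. strict_prefix (d # q) q' \<and> strict_prefix q' (d # p) \<longrightarrow> P q') \<longleftrightarrow>
    (\<forall>q'. strict_prefix q q' \<and> strict_prefix q' p \<longrightarrow> P (d # q'))"
  "(\<forall>q'. strict_prefix [] q' \<and> strict_prefix q' (d # p) \<longrightarrow> P q') \<longleftrightarrow>
    (\<forall>q'. strict_prefix q' p \<longrightarrow> P (d # q'))"
  unfolding strict_prefix_Cons_iff by auto

lemma binds_Var: "\<not> binds (Var y) q x p"
  by (simp add: binds_iff)

lemma free_at_Var: "free_at (Var y) x p \<longleftrightarrow> x = y \<and> p = []"
  by (auto simp: free_at_iff subterm_at_simps)

lemma binds_App: "binds (App t u) q x p \<longleftrightarrow>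
    (\<exists>q' p'. q = Fun_dir # q' \<and> p = Fun_dir # p' \<and> binds t q' x p') \<or>
    (\<exists>q' p'. q = Arg_dir # q' \<and> p = Arg_dir # p' \<and> binds u q' x p')"
proof (cases p)
  case (Cons d p')
  then show ?thesis unfolding binds_iff
    by (cases d; cases q; cases "hd q") (auto simp: all_between_Cons)
qed (simp add: binds_iff)

lemma free_at_App: "free_at (App t u) x p \<longleftrightarrow>
    (\<exists>q. p = Fun_dir # q \<and> free_at t x q) \<or> (\<exists>q. p = Arg_dir # q \<and> free_at u x q)"
proof (cases p)
  case (Cons d p')
  then show ?thesis unfolding free_at_iff
    by (cases d) (auto simp: all_strict_prefix_Cons)
qed (simp add: free_at_iff)

lemma free_at_Lam: "free_at (Lam y t) x p \<longleftrightarrow> x \<noteq> y \<and> (\<exists>q. p = Body_dir # q \<and> free_at t x q)"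
proof (cases p)
  case (Cons d p')
  then show ?thesis unfolding free_at_iff
    by (cases d) (auto simp: all_strict_prefix_Cons)
qed (simp add: free_at_iff)

lemma binds_Lam: "binds (Lam y t) q x p \<longleftrightarrow>
    (\<exists>q' p'. q = Body_dir # q' \<and> p = Body_dir # p' \<and> binds t q' x p') \<or>
    (\<exists>p'. q = [] \<and> p = Body_dir # p' \<and> x = y \<and> free_at t y p')"
proof (cases p)
  case (Cons d p')
  then show ?thesis unfolding binds_iff free_at_iff
    by (cases d; cases q; cases "hd q") (auto simp: all_between_Cons)
qed (simp add: binds_iff)

lemmas binds_simps = binds_Var binds_App binds_Lam
lemmas free_at_simps = free_at_Var free_at_App free_at_Lam

lemma free_at_fv: "free_at t x p \<Longrightarrow> x \<in> fv t"
  by (induction t arbitrary: p) (auto simp: free_at_simps)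

lemma fv_free_at: "x \<in> fv t \<Longrightarrow> \<exists>p. free_at t x p"
proof (induction t)
  case (Var y)
  then show ?case by (simp add: free_at_simps)
next
  case (App t u)
  then have "(\<exists>p. free_at t x p) \<or> (\<exists>p. free_at u x p)" by auto
  then show ?case unfolding free_at_App by blast
next
  case (Lam y t)
  then have "x \<noteq> y" "\<exists>p. free_at t x p" by auto
  then show ?case unfolding free_at_Lam by blast
qed

lemma free_at_unique: "uses_once t \<Longrightarrow> free_at t x p \<Longrightarrow> free_at t x p' \<Longrightarrow> p = p'"
  by (induction t arbitrary: p p') (auto simp: free_at_simps disjoint_iff dest: free_at_fv)

text \<open>This is where \<open>x \<in> fv t\<close> at abstractions is used: every parameter
  occurs, so no parameter element is left without a partner.\<close>

lemma binds_exists: "uses_once t \<Longrightarrow> is_lam_at t q \<Longrightarrow> \<exists>x p. binds t q x p"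
proof (induction t arbitrary: q)
  case (Lam y t)
  obtain p where p: "free_at t y p" using Lam.prems fv_free_at by auto
  consider "q = []" | q' where "q = Body_dir # q'" "is_lam_at t q'"
    using Lam.prems by (auto simp: is_lam_at_simps)
  then show ?case
  proof cases
    case 1
    then have "binds (Lam y t) q y (Body_dir # p)" using p by (simp add: binds_Lam)
    then show ?thesis by blast
  next
    case 2
    then obtain x p where "binds t q' x p" using Lam.IH[of q'] Lam.prems(1) by fastforce
    then have "binds (Lam y t) q x (Body_dir # p)" using 2 by (simp add: binds_Lam)
    then show ?thesis by blast
  qed
next
  case (App t u)
  consider q' where "q = Fun_dir # q'" "is_lam_at t q'" | q' where "q = Arg_dir # q'" "is_lam_at u q'"
    using App.prems by (auto simp: is_lam_at_simps)
  then show ?case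
  proof cases
    case 1
    then obtain x p where "binds t q' x p" using App.IH App.prems(1) by fastforce
    then have "binds (App t u) q x (Fun_dir # p)" using 1 by (simp add: binds_App)
    then show ?thesis by blast
  next
    case 2
    then obtain x p where "binds u q' x p" using App.IH App.prems(1) by fastforce
    then have "binds (App t u) q x (Arg_dir # p)" using 2 by (simp add: binds_App)
    then show ?thesis by blast
  qed
qed (simp add: is_lam_at_simps)

lemma binds_unique:
  "uses_once t \<Longrightarrow> binds t q x p \<Longrightarrow> binds t q x' p' \<Longrightarrow> p = p'"
  by (induction t arbitrary: q p p') (auto simp: binds_simps dest: free_at_unique)

lemma binds_functional: "binds t q x p \<Longrightarrow> binds t q' x' p \<Longrightarrow> q = q' \<and> x = x'"
proof (induction t arbitrary: q q' p)
  case (Lam y t)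
  \<comment> \<open>An occurrence free in the body has no binder there, so the outermost abstraction
    never competes with an inner one.\<close>
  have "\<not> binds t q x p" if "free_at t y p" for q x p
    using that by (auto simp: free_at_def binds_def)
  with Lam show ?case by (auto simp: binds_simps)
qed (auto simp: binds_simps)

lemma binds_is_lam_at: "binds t q x p \<Longrightarrow> is_lam_at t q"
  by (auto simp: binds_def is_lam_at_def)

section \<open>The involution of a linear term\<close>

lemma receiver_simps [simp]:
  "receiver [] = Root_elt" "receiver (p @ [Fun_dir]) = Fun_elt p"
  "receiver (p @ [Arg_dir]) = Arg_elt p" "receiver (p @ [Body_dir]) = Body_elt p"
  by (auto simp: receiver_def)

lemma receiver_cases:
  obtains "p = []" "receiver p = Root_elt"
  | q where "p = q @ [Fun_dir]" "receiver p = Fun_elt q"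
  | q where "p = q @ [Arg_dir]" "receiver p = Arg_elt q"
  | q where "p = q @ [Body_dir]" "receiver p = Body_elt q"
proof (cases p rule: rev_cases)
  case (snoc q d)
  then show ?thesis by (cases d) (auto intro: that)
qed (auto intro: that)

lemma receiver_inj: "receiver p = receiver q \<Longrightarrow> p = q"
  by (cases p rule: receiver_cases; cases q rule: receiver_cases) auto

lemma produces_not_receiver: "produces t p z \<Longrightarrow> z \<noteq> receiver q"
  by (cases q rule: receiver_cases) (auto elim: produces.cases)

lemma produces_functional: "produces t p z \<Longrightarrow> produces t p z' \<Longrightarrow> z = z'"
  by (auto elim!: produces.cases dest: binds_functional
      simp: is_app_at_def is_lam_at_def) (auto simp: binds_def)

lemma produces_unique: "uses_once t \<Longrightarrow> produces t p z \<Longrightarrow> produces t q z \<Longrightarrow> p = q"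
  by (auto elim!: produces.cases dest: binds_unique)

text \<open>No element both produces and receives, and on either side the element and the path
  determine each other. Hence the description in \<open>term_emap\<close> has exactly one
  candidate.\<close>

lemma term_emap_produces:
  assumes "uses_once t" "produces t p z"
  shows "term_emap t z = receiver p" "term_emap t (receiver p) = z"
proof -
  have "swapped t z w \<longleftrightarrow> w = receiver p" for w
    unfolding swapped_def
    using assms produces_unique produces_not_receiver receiver_inj produces_functional by metis
  then show "term_emap t z = receiver p" by (auto simp: term_emap_def intro: the_equality)
  have "swapped t (receiver p) w \<longleftrightarrow> w = z" for w
    unfolding swapped_def
    using assms produces_unique produces_not_receiver receiver_inj produces_functional by metis
  then show "term_emap t (receiver p) = z" by (auto simp: term_emap_def intro: the_equality)
qed

lemma term_emap_free:
  assumes "free_at t x p"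
  shows "term_emap t (receiver p) = receiver p"
proof -
  have "\<not> produces t p z" for z
    using assms by (auto elim!: produces.cases simp: free_at_def is_app_at_def is_lam_at_def)
      (auto simp: binds_def)
  then have "\<not> swapped t (receiver p) w" for w
    unfolding swapped_def using produces_not_receiver receiver_inj by metis
  then show ?thesis by (auto simp: term_emap_def)
qed

lemma produces_subterm: "produces t p z \<Longrightarrow> subterm_at t p \<noteq> None"
  by (auto elim!: produces.cases simp: is_app_at_def is_lam_at_def binds_def)

lemma produces_elts: "produces t p z \<Longrightarrow> z \<in> elts t"
  by (auto elim!: produces.cases simp: elts_def dest: binds_is_lam_at)

lemma receiver_elts: "subterm_at t p \<noteq> None \<Longrightarrow> receiver p \<in> elts t"
  by (cases p rule: receiver_cases) (auto simp: elts_def subterm_at_snoc[unfolded not_None_eq])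

lemma produces_or_free:
  assumes "subterm_at t p \<noteq> None"
  obtains z where "produces t p z" | x where "free_at t x p"
proof -
  obtain s where s: "subterm_at t p = Some s" using assms by blast
  show ?thesis
  proof (cases s)
    case (Var x)
    then show ?thesis using s that produces.var by (metis free_at_def)
  next
    case App
    then show ?thesis using s that produces.app by (metis is_app_at_def)
  next
    case Lam
    then show ?thesis using s that produces.lam by (metis is_lam_at_def)
  qed
qed

text \<open>The kind of the element decides, except that a parameter element needs an occurrence to
  produce; only there does linearity enter.\<close>

lemma elts_cases:
  assumes "uses_once t" "z \<in> elts t"
  obtains p where "subterm_at t p \<noteq> None" "z = receiver p" | p where "produces t p z"
proof (cases z)
  case Root_elt
  then show ?thesis using that(1)[of "[]"] by simp
next
  case (Fun_elt p)
  then show ?thesis using that(1)[of "p @ [Fun_dir]"] assms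
    by (auto simp: elts_def subterm_at_snoc[unfolded not_None_eq])
next
  case (Arg_elt p)
  then show ?thesis using that(1)[of "p @ [Arg_dir]"] assms
    by (auto simp: elts_def subterm_at_snoc[unfolded not_None_eq])
next
  case (Body_elt p)
  then show ?thesis using that(1)[of "p @ [Body_dir]"] assms
    by (auto simp: elts_def subterm_at_snoc[unfolded not_None_eq])
next
  case (Cont_elt p)
  then show ?thesis using that(2)[of p] assms by (auto simp: elts_def intro: produces.app)
next
  case (Lam_elt p)
  then show ?thesis using that(2)[of p] assms by (auto simp: elts_def intro: produces.lam)
next
  case (Param_elt p)
  then have "is_lam_at t p" using assms by (auto simp: elts_def)
  then obtain x q where "binds t p x q" using binds_exists assms by blast
  then show ?thesis using that(2)[of q] Param_elt by (auto intro: produces.var)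
qed

lemma term_emap_involution:
  assumes "uses_once t" "z \<in> elts t"
  shows "term_emap t z \<in> elts t" "term_emap t (term_emap t z) = z"
proof -
  have "term_emap t z \<in> elts t \<and> term_emap t (term_emap t z) = z"
    using assms
  proof (cases rule: elts_cases)
    case (1 p)
    then show ?thesis
    proof (cases rule: produces_or_free)
      case (1 w)
      then show ?thesis using term_emap_produces[OF assms(1) 1] \<open>z = receiver p\<close> produces_elts by metis
    next
      case (2 x)
      then show ?thesis using term_emap_free[OF 2] \<open>z = receiver p\<close> assms by metis
    qed
  next
    case (2 p)
    then show ?thesis using term_emap_produces[OF assms(1) 2] produces_subterm receiver_elts by metis
  qed
  then show "term_emap t z \<in> elts t" "term_emap t (term_emap t z) = z" by auto
qed

lemma term_vmap_elts: "z \<in> elts t \<Longrightarrow> term_vmap z \<in> elts t"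
  by (cases z) (auto simp: elts_def)

lemma term_vmap_cube: "term_vmap (term_vmap (term_vmap z)) = z"
  by (cases z) auto

lemma card_elts: "finite (elts t)" "card (elts t) = 1 + 3 * (apps t + lams t)"
proof -
  let ?A = "\<lambda>t. {p. is_app_at t p}" and ?L = "\<lambda>t. {p. is_lam_at t p}"
  have appA: "?A (App t u) = insert [] ((#) Fun_dir ` ?A t \<union> (#) Arg_dir ` ?A u)" for t u
    by (auto simp: is_app_at_simps)
  have lamA: "?A (Lam x t) = (#) Body_dir ` ?A t" for x t
    by (auto simp: is_app_at_simps)
  have appL: "?L (App t u) = (#) Fun_dir ` ?L t \<union> (#) Arg_dir ` ?L u" for t u
    by (auto simp: is_lam_at_simps)
  have lamL: "?L (Lam x t) = insert [] ((#) Body_dir ` ?L t)" for x t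
    by (auto simp: is_lam_at_simps)
  have A: "finite (?A t) \<and> card (?A t) = apps t" for t
  proof (induction t)
    case (App t u)
    then show ?case unfolding appA
      by (subst card_insert_disjoint, (auto)[2], subst card_Un_disjoint) (auto simp: card_image)
  qed (simp_all add: lamA is_app_at_simps(1) card_image)
  have L: "finite (?L t) \<and> card (?L t) = lams t" for t
  proof (induction t)
    case (App t u)
    then show ?case unfolding appL
      by (subst card_Un_disjoint) (auto simp: card_image)
  qed (auto simp: lamL is_lam_at_simps(1) card_image image_iff)
  have elts: "elts t = insert Root_elt (Fun_elt ` ?A t \<union> Arg_elt ` ?A t \<union> Cont_elt ` ?A t
      \<union> (Lam_elt ` ?L t \<union> Param_elt ` ?L t \<union> Body_elt ` ?L t))"
    by (auto simp: elts_def)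
  show "finite (elts t)" using A L by (simp add: elts)
  show "card (elts t) = 1 + 3 * (apps t + lams t)"
    unfolding elts using A[of t] L[of t]
    by (subst card_insert_disjoint, (auto)[2], (subst card_Un_disjoint, (auto)[3])+)
      (simp add: card_image inj_on_def)
qed

lemma reachable_term:
  assumes "uses_once t" "z \<in> elts t"
  shows "reachable (underlying_map \<Gamma> t) Root_elt z"
proof -
  let ?M = "underlying_map \<Gamma> t"
  have v: "reachable ?M Root_elt w \<Longrightarrow> reachable ?M Root_elt (term_vmap w)" for w
    using reachable.vmap[of ?M] by (simp add: underlying_map_def)
  have e: "reachable ?M Root_elt w \<Longrightarrow> reachable ?M Root_elt (term_emap t w)" for w
    using reachable.emap[of ?M] by (simp add: underlying_map_def)
  \<comment> \<open>Descent along the path: \<open>e\<close> crosses to the vertex at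
    \<open>p\<close>, and one or two moves by \<open>v\<close> lead to the receiving elements of the
    immediate subterms.\<close>
  have p: "reachable ?M Root_elt (receiver p)" if "subterm_at t p \<noteq> None" for p
    using that
  proof (induction p rule: rev_induct)
    case Nil
    then show ?case by (simp add: reachable.refl)
  next
    case (snoc d p)
    then have "subterm_at t p \<noteq> None" by (auto simp: subterm_at_append split: option.splits)
    then have r: "reachable ?M Root_elt (receiver p)" using snoc.IH by blast
    from snoc.prems consider "is_app_at t p" "d = Fun_dir \<or> d = Arg_dir" | "is_lam_at t p" "d = Body_dir"
      by (auto simp: subterm_at_snoc[unfolded not_None_eq])
    then show ?case
    proof cases
      case 1
      have "reachable ?M Root_elt (Cont_elt p)"
        using e[OF r] term_emap_produces(2)[OF assms(1) produces.app[OF 1(1)]] by simp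
      then show ?thesis using v[of "Cont_elt p"] v[of "Arg_elt p"] 1(2) by auto
    next
      case 2
      have "reachable ?M Root_elt (Lam_elt p)"
        using e[OF r] term_emap_produces(2)[OF assms(1) produces.lam[OF 2(1)]] by simp
      then show ?thesis using v[of "Lam_elt p"] v[of "Param_elt p"] 2(2) by auto
    qed
  qed
  show ?thesis using assms
  proof (cases rule: elts_cases)
    case (2 q)
    then show ?thesis
      using e[OF p[OF produces_subterm[OF 2]]] term_emap_produces(2)[OF assms(1) 2] by simp
  qed (use p in auto)
qed

section \<open>Decoding a term inside a map\<close>

locale trivalent_map =
  fixes M :: "'a rtmap"
  assumes rooted: "rooted_trivalent_map M"
begin

abbreviation "A \<equiv> carrier M"
abbreviation "v \<equiv> vmap M"
abbreviation "e \<equiv> emap M"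
abbreviation "r \<equiv> root_elt M"

lemma transitive: "transitive_T_set M"
  using rooted by (simp add: rooted_trivalent_map_def)

lemma v_in [simp, intro]: "x \<in> A \<Longrightarrow> v x \<in> A"
  and v_cube [simp]: "x \<in> A \<Longrightarrow> v (v (v x)) = x"
  and e_in [simp, intro]: "x \<in> A \<Longrightarrow> e x \<in> A"
  and e_e [simp]: "x \<in> A \<Longrightarrow> e (e x) = x"
  and reach: "x \<in> A \<Longrightarrow> y \<in> A \<Longrightarrow> reachable M x y"
  using transitive_T_setD[OF transitive] by (blast, blast, blast, blast, blast)

lemma v_fixed: "{x \<in> A. v x = x} = {r}" and e_fixed: "{x \<in> A. e x = x} = set (boundary M)"
  and distinct_boundary: "distinct (boundary M)"
  using rooted by (auto simp: rooted_trivalent_map_def)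

lemma r_in [simp]: "r \<in> A" and v_r [simp]: "v r = r"
proof -
  have "r \<in> {x \<in> A. v x = x}" unfolding v_fixed by simp
  then show "r \<in> A" "v r = r" by simp_all
qed

lemma v_fixed_root: "x \<in> A \<Longrightarrow> v x = x \<Longrightarrow> x = r"
  using v_fixed by (metis (mono_tags, lifting) mem_Collect_eq singletonD)

lemma boundary_in: "b \<in> set (boundary M) \<Longrightarrow> b \<in> A \<and> e b = b"
  using e_fixed by (metis (mono_tags, lifting) mem_Collect_eq)

text \<open>A vertex is entered at a continuation or at the root element of an abstraction. Since
  \<open>v\<close> runs through continuation, argument, function and through root, parameter, body,
  function and body lie at the same position; \<open>walk\<close> thus depends on the path alone,
  not on the term.\<close>

fun go :: "dir \<Rightarrow> 'a \<Rightarrow> 'a" where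
  "go Fun_dir x = v (v (e x))"
| "go Arg_dir x = v (e x)"
| "go Body_dir x = v (v (e x))"

fun walk :: "'a \<Rightarrow> path \<Rightarrow> 'a" where
  "walk x [] = x"
| "walk x (d # p) = walk (go d x) p"

lemma walk_append: "walk x (p @ q) = walk (walk x p) q"
  by (induction p arbitrary: x) auto

lemma go_in [simp, intro]: "x \<in> A \<Longrightarrow> go d x \<in> A"
  by (cases d) auto

lemma walk_in [simp, intro]: "x \<in> A \<Longrightarrow> walk x p \<in> A"
  by (induction p arbitrary: x) auto

text \<open>Here \<open>x\<close> is the element of the map that receives the term, and \<open>\<rho>\<close> gives the element
  producing the occurrences of each name (the boundary element itself for a free variable).\<close>

fun decodes :: "(nat \<Rightarrow> 'a) \<Rightarrow> 'a \<Rightarrow> trm \<Rightarrow> bool" where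
  "decodes \<rho> x (Var a) \<longleftrightarrow> \<rho> a = e x"
| "decodes \<rho> x (App t u) \<longleftrightarrow> decodes \<rho> (v (v (e x))) t \<and> decodes \<rho> (v (e x)) u"
| "decodes \<rho> x (Lam a t) \<longleftrightarrow> decodes (\<rho>(a := v (e x))) (v (v (e x))) t"

definition triple :: "'a \<Rightarrow> 'a set" where
  "triple z = {z, v z, v (v z)}"

text \<open>\<open>U\<close> grows by the vertices on the branch above, and both parts of an
  application start from the same set, exactly as when vertices of the map are cut apart.\<close>

fun fresh :: "'a set \<Rightarrow> 'a \<Rightarrow> trm \<Rightarrow> bool" where
  "fresh U x (Var a) \<longleftrightarrow> True"
| "fresh U x (App t u) \<longleftrightarrow> e x \<notin> U \<and> fresh (U \<union> triple (e x)) (v (v (e x))) t \<and>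
    fresh (U \<union> triple (e x)) (v (e x)) u"
| "fresh U x (Lam a t) \<longleftrightarrow> e x \<notin> U \<and> fresh (U \<union> triple (e x)) (v (v (e x))) t"

text \<open>Unrolls the recursion into one equation per variable occurrence. The update of \<rho> at
  an abstraction becomes the equations for the occurrences that it binds.\<close>

lemma decodes_iff:
  "decodes \<rho> x t \<longleftrightarrow> (\<forall>p a. free_at t a p \<longrightarrow> e (walk x p) = \<rho> a) \<and>
    (\<forall>p a q. binds t q a p \<longrightarrow> e (walk x p) = v (e (walk x q)))"
proof (induction t arbitrary: \<rho> x)
  case (Var y)
  then show ?case by (auto simp: free_at_simps binds_simps)
next
  case (App t u)
  have free: "(\<forall>p a. free_at (App t u) a p \<longrightarrow> P p a) \<longleftrightarrow>
      (\<forall>p a. free_at t a p \<longrightarrow> P (Fun_dir # p) a) \<and> (\<forall>p a. free_at u a p \<longrightarrow> P (Arg_dir # p) a)" for P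
    unfolding free_at_App by blast
  have bound: "(\<forall>p a q. binds (App t u) q a p \<longrightarrow> P p q) \<longleftrightarrow>
      (\<forall>p a q. binds t q a p \<longrightarrow> P (Fun_dir # p) (Fun_dir # q)) \<and>
      (\<forall>p a q. binds u q a p \<longrightarrow> P (Arg_dir # p) (Arg_dir # q))" for P
    unfolding binds_App by blast
  show ?case unfolding decodes.simps App.IH free bound walk.simps go.simps by argo
next
  case (Lam y t)
  have free: "(\<forall>p a. free_at (Lam y t) a p \<longrightarrow> P p a) \<longleftrightarrow>
      (\<forall>p a. a \<noteq> y \<longrightarrow> free_at t a p \<longrightarrow> P (Body_dir # p) a)" for P
    unfolding free_at_Lam by blast
  have bound: "(\<forall>p a q. binds (Lam y t) q a p \<longrightarrow> P p q) \<longleftrightarrow>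
      (\<forall>p. free_at t y p \<longrightarrow> P (Body_dir # p) []) \<and>
      (\<forall>p a q. binds t q a p \<longrightarrow> P (Body_dir # p) (Body_dir # q))" for P
    unfolding binds_Lam by blast
  have upd: "(\<forall>p a. free_at t a p \<longrightarrow> P p = (\<rho>(y := w)) a) \<longleftrightarrow>
      (\<forall>p. free_at t y p \<longrightarrow> P p = w) \<and> (\<forall>p a. a \<noteq> y \<longrightarrow> free_at t a p \<longrightarrow> P p = \<rho> a)" for P w
    by (simp add: fun_upd_def) metis
  show ?case unfolding decodes.simps Lam.IH free bound upd walk.simps go.simps by argo
qed

lemma fresh_antimono: "fresh U x t \<Longrightarrow> U' \<subseteq> U \<Longrightarrow> fresh U' x t"
proof (induction t arbitrary: U U' x)
  case (App t u)
  have sub: "U' \<union> triple z \<subseteq> U \<union> triple z" for z using App.prems(2) by blast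
  from App.prems show ?case using App.IH[OF _ sub] by auto
next
  case (Lam a t)
  have sub: "U' \<union> triple z \<subseteq> U \<union> triple z" for z using Lam.prems(2) by blast
  from Lam.prems show ?case using Lam.IH[OF _ sub] by auto
qed simp

lemma fresh_not_in: "fresh U x t \<Longrightarrow> is_app_at t p \<or> is_lam_at t p \<Longrightarrow> e (walk x p) \<notin> U"
proof (induction t arbitrary: x p)
  case (App t u)
  have "fresh U (v (v (e x))) t" "fresh U (v (e x)) u"
    using App.prems(1) fresh_antimono by (auto intro: fresh_antimono)
  then show ?case using App by (auto simp: is_app_at_simps is_lam_at_simps)
next
  case (Lam a t)
  have "fresh U (v (v (e x))) t"
    using Lam.prems(1) by (auto intro: fresh_antimono)
  then show ?case using Lam by (auto simp: is_app_at_simps is_lam_at_simps)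
qed (simp add: is_app_at_simps is_lam_at_simps)

section \<open>From decodings to isomorphisms\<close>

fun place :: "elt \<Rightarrow> 'a" where
  "place Root_elt = r"
| "place (Cont_elt p) = e (walk r p)"
| "place (Arg_elt p) = v (e (walk r p))"
| "place (Fun_elt p) = v (v (e (walk r p)))"
| "place (Lam_elt p) = e (walk r p)"
| "place (Param_elt p) = v (e (walk r p))"
| "place (Body_elt p) = v (v (e (walk r p)))"

lemma place_receiver: "place (receiver p) = walk r p"
  by (cases p rule: receiver_cases) (auto simp: walk_append)

lemma place_in: "place z \<in> A"
  by (cases z) auto

lemma place_vmap: "place (term_vmap z) = v (place z)"
  by (cases z) auto

text \<open>This is all the injectivity that has to be checked: an equivariant map between transitive
  sets is injective as soon as one fibre is a singleton.\<close>

lemma place_root: "fresh {r} r t \<Longrightarrow> z \<in> elts t \<Longrightarrow> place z = r \<Longrightarrow> z = Root_elt"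
proof -
  assume F: "fresh {r} r t" and z: "z \<in> elts t" "place z = r"
  \<comment> \<open>As \<open>v\<close> fixes \<open>r\<close>, a vertex can meet \<open>r\<close>
    in any of its elements only if its entering element is \<open>r\<close>.\<close>
  have orb: "y = r" if "y \<in> A" "v y = r \<or> v (v y) = r" for y
    using that by (metis v_cube v_r)
  have "e (walk r p) \<noteq> r" if "is_app_at t p \<or> is_lam_at t p" for p
    using fresh_not_in[OF F that] by simp
  then show ?thesis using z orb[of "e (walk r _)"]
    by (cases z) (auto simp: elts_def)
qed

lemma place_emap:
  assumes "uses_once t" "decodes \<rho> r t" "\<And>a. a \<in> fv t \<Longrightarrow> e (\<rho> a) = \<rho> a" "z \<in> elts t"
  shows "place (term_emap t z) = e (place z)"
proof -
  have prod: "place z = e (place (receiver p))" if "produces t p z" for p z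
    using that assms(2) unfolding place_receiver decodes_iff by cases auto
  have free: "e (walk r p) = walk r p" if "free_at t a p" for a p
  proof -
    have "e (walk r p) = \<rho> a" using that assms(2) by (auto simp: decodes_iff)
    then show ?thesis using assms(3)[OF free_at_fv[OF that]] by (metis e_e r_in walk_in)
  qed
  show ?thesis using assms(1,4)
  proof (cases rule: elts_cases)
    case (1 p)
    from 1(1) show ?thesis
    proof (cases rule: produces_or_free)
      case (1 w)
      then show ?thesis using term_emap_produces[OF assms(1) 1] prod \<open>z = receiver p\<close> by simp
    next
      case (2 a)
      then show ?thesis using term_emap_free[OF 2] free[OF 2] \<open>z = receiver p\<close> by (simp add: place_receiver)
    qed
  next
    case (2 p)
    then show ?thesis using term_emap_produces[OF assms(1) 2] prod[OF 2] by (simp add: place_in)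
  qed
qed

lemma free_at_The:
  assumes "uses_once t" "a \<in> fv t"
  shows "free_at t a (THE p. free_at t a p)"
proof -
  obtain p where p: "free_at t a p" using fv_free_at assms(2) by blast
  then have "(THE p. free_at t a p) = p"
    using free_at_unique[OF assms(1)] by (intro the_equality) auto
  then show ?thesis using p by simp
qed

lemma decodes_iso:
  assumes lin: "linear \<Gamma> t" and dec: "decodes \<rho> r t" and fr: "fresh {r} r t"
    and bd: "map \<rho> \<Gamma> = boundary M"
  shows "rtmap_iso (underlying_map \<Gamma> t) M place"
proof -
  let ?N = "underlying_map \<Gamma> t"
  have once: "uses_once t" and \<Gamma>: "set \<Gamma> = fv t" using lin by (auto simp: linear_iff)
  have \<rho>: "e (\<rho> a) = \<rho> a" "\<rho> a \<in> A" if "a \<in> fv t" for a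
    using that boundary_in bd \<Gamma> by (metis imageI list.set_map)+
  have e: "place (term_emap t z) = e (place z)" if "z \<in> elts t" for z
    using place_emap[OF once dec \<rho>(1) that] .
  have N: "vmap ?N = term_vmap" "emap ?N = term_emap t" by (simp_all add: underlying_map_def)
  \<comment> \<open>The elements alone in their fibre under \<open>place\<close> include the root by
    \<open>place_root\<close> and are closed under both moves, because \<open>v\<close> is undone by
    \<open>v\<close> twice and \<open>e\<close> by \<open>e\<close>. Reachability from the root then
    yields injectivity everywhere.\<close>
  have "reachable ?N x z \<Longrightarrow> x = Root_elt \<Longrightarrow>
      z \<in> elts t \<and> (\<forall>z'\<in>elts t. place z = place z' \<longrightarrow> z = z')" for x z
  proof (induction rule: reachable.induct)
    case (refl x)
    have "Root_elt \<in> elts t" by (simp add: elts_def)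
    then show ?case using place_root[OF fr] refl by (metis place.simps(1))
  next
    case (vmap x y)
    have "term_vmap y = z'" if "z' \<in> elts t" "place (term_vmap y) = place z'" for z'
    proof -
      have "v (place y) = place z'" using that(2) by (simp only: place_vmap)
      then have "place (term_vmap (term_vmap z')) = v (v (v (place y)))"
        by (simp only: place_vmap)
      also have "\<dots> = place y" by (simp add: place_in)
      finally have "y = term_vmap (term_vmap z')" using vmap that(1) term_vmap_elts by metis
      then show ?thesis by (simp only: term_vmap_cube)
    qed
    then show ?case using vmap.IH[OF vmap.prems] term_vmap_elts unfolding N by blast
  next
    case (emap x y)
    have y: "y \<in> elts t" using emap by blast
    have "term_emap t y = z'" if "z' \<in> elts t" "place (term_emap t y) = place z'" for z'
    proof -
      have "e (place y) = place z'" using that(2) e[OF y] by (simp only:)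
      then have "place (term_emap t z') = e (e (place y))"
        by (simp only: e[OF that(1)])
      also have "\<dots> = place y" by (simp add: place_in)
      finally have "y = term_emap t z'"
        using emap that(1) term_emap_involution(1)[OF once] by metis
      then show ?thesis using term_emap_involution(2)[OF once that(1)] by (simp only:)
    qed
    then show ?case using y term_emap_involution(1)[OF once] unfolding N by blast
  qed
  then have inj: "z = z'" if "reachable ?N Root_elt z" "z' \<in> elts t" "place z = place z'" for z z'
    using that by blast
  have "y \<in> place ` elts t" if "reachable M x y" "x = r" for x y
    using that
  proof (induction rule: reachable.induct)
    case (refl x)
    then show ?case by (auto simp: elts_def intro!: image_eqI[of _ _ Root_elt])
  next
    case (vmap x y)
    then obtain z where "z \<in> elts t" "y = place z" by blast
    then show ?case by (intro image_eqI[of _ _ "term_vmap z"]) (auto simp: place_vmap term_vmap_elts)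
  next
    case (emap x y)
    then obtain z where "z \<in> elts t" "y = place z" by blast
    then show ?case by (intro image_eqI[of _ _ "term_emap t z"]) (auto simp: e term_emap_involution once)
  qed
  from this[OF reach[OF r_in] HOL.refl] have "A \<subseteq> place ` elts t" by (rule subsetI)
  then have surj: "place ` elts t = A" by (auto simp: place_in)
  have bij: "bij_betw place (elts t) A"
    unfolding bij_betw_def using surj by (blast intro: inj_onI inj reachable_term[OF once])
  have "place (receiver (THE p. free_at t a p)) = \<rho> a" if "a \<in> set \<Gamma>" for a
  proof -
    have f: "free_at t a (THE p. free_at t a p)" using free_at_The once \<Gamma> that by auto
    then have "e (walk r (THE p. free_at t a p)) = \<rho> a" using dec unfolding decodes_iff by blast
    then show ?thesis using \<rho> that \<Gamma> by (metis e_e place_receiver r_in walk_in)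
  qed
  then have "map (\<lambda>a. place (receiver (THE p. free_at t a p))) \<Gamma> = map \<rho> \<Gamma>"
    by (intro map_cong) auto
  then have "map place (boundary ?N) = boundary M"
    using bd by (simp add: underlying_map_def comp_def)
  then show ?thesis
    using bij e by (auto simp: rtmap_iso_def underlying_map_def place_vmap)
qed

section \<open>From isomorphisms back to decodings\<close>

lemma fresh_paths:
  assumes "\<And>p. is_app_at t p \<or> is_lam_at t p \<Longrightarrow> e (walk x p) \<notin> U \<and>
    (\<forall>q. strict_prefix q p \<longrightarrow> e (walk x p) \<notin> triple (e (walk x q)))"
  shows "fresh U x t"
  using assms
proof (induction t arbitrary: U x)
  case (App t u)
  have "fresh (U \<union> triple (e x)) (v (v (e x))) t"
  proof (rule App.IH(1))
    fix p assume "is_app_at t p \<or> is_lam_at t p"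
    then have "is_app_at (App t u) (Fun_dir # p) \<or> is_lam_at (App t u) (Fun_dir # p)"
      by (simp add: is_app_at_simps is_lam_at_simps)
    from App.prems[OF this, unfolded all_strict_prefix_Cons]
    show "e (walk (v (v (e x))) p) \<notin> U \<union> triple (e x) \<and>
      (\<forall>q. strict_prefix q p \<longrightarrow> e (walk (v (v (e x))) p) \<notin> triple (e (walk (v (v (e x))) q)))"
      by simp
  qed
  moreover have "fresh (U \<union> triple (e x)) (v (e x)) u"
  proof (rule App.IH(2))
    fix p assume "is_app_at u p \<or> is_lam_at u p"
    then have "is_app_at (App t u) (Arg_dir # p) \<or> is_lam_at (App t u) (Arg_dir # p)"
      by (simp add: is_app_at_simps is_lam_at_simps)
    from App.prems[OF this, unfolded all_strict_prefix_Cons]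
    show "e (walk (v (e x)) p) \<notin> U \<union> triple (e x) \<and>
      (\<forall>q. strict_prefix q p \<longrightarrow> e (walk (v (e x)) p) \<notin> triple (e (walk (v (e x)) q)))"
      by simp
  qed
  ultimately show ?case using App.prems[of "[]"] by (simp add: is_app_at_simps)
next
  case (Lam a t)
  have "fresh (U \<union> triple (e x)) (v (v (e x))) t"
  proof (rule Lam.IH)
    fix p assume "is_app_at t p \<or> is_lam_at t p"
    then have "is_app_at (Lam a t) (Body_dir # p) \<or> is_lam_at (Lam a t) (Body_dir # p)"
      by (simp add: is_app_at_simps is_lam_at_simps)
    from Lam.prems[OF this, unfolded all_strict_prefix_Cons]
    show "e (walk (v (v (e x))) p) \<notin> U \<union> triple (e x) \<and>
      (\<forall>q. strict_prefix q p \<longrightarrow> e (walk (v (v (e x))) p) \<notin> triple (e (walk (v (v (e x))) q)))"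
      by simp
  qed
  then show ?case using Lam.prems[of "[]"] by (simp add: is_lam_at_simps)
qed simp

text \<open>Compatibility with the root, \<open>v\<close> and \<open>e\<close> leaves no choice: the
  receiving elements are reached from the root by the very moves that \<open>walk\<close>
  performs.\<close>

lemma iso_place:
  assumes once: "uses_once t" and iso: "rtmap_iso (underlying_map \<Gamma> t) M f" and z: "z \<in> elts t"
  shows "f z = place z"
proof -
  have v: "f (term_vmap z) = v (f z)" and e: "f (term_emap t z) = e (f z)" if "z \<in> elts t" for z
    using iso that by (auto simp: rtmap_iso_def underlying_map_def)
  have app: "f (Cont_elt p) = e (walk r p)" "f (Arg_elt p) = v (e (walk r p))"
      "f (Fun_elt p) = v (v (e (walk r p)))"
    if "is_app_at t p" "f (receiver p) = walk r p" for p
  proof -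
    have "receiver p \<in> elts t" using that by (intro receiver_elts) (auto simp: is_app_at_def)
    then show c: "f (Cont_elt p) = e (walk r p)"
      using e[of "receiver p"] term_emap_produces(2)[OF once produces.app[OF that(1)]] that by simp
    have "Cont_elt p \<in> elts t" "Arg_elt p \<in> elts t" using that by (auto simp: elts_def)
    then show "f (Arg_elt p) = v (e (walk r p))" "f (Fun_elt p) = v (v (e (walk r p)))"
      using v[of "Cont_elt p"] v[of "Arg_elt p"] c by auto
  qed
  have lam: "f (Lam_elt p) = e (walk r p)" "f (Param_elt p) = v (e (walk r p))"
      "f (Body_elt p) = v (v (e (walk r p)))"
    if "is_lam_at t p" "f (receiver p) = walk r p" for p
  proof -
    have "receiver p \<in> elts t" using that by (intro receiver_elts) (auto simp: is_lam_at_def)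
    then show c: "f (Lam_elt p) = e (walk r p)"
      using e[of "receiver p"] term_emap_produces(2)[OF once produces.lam[OF that(1)]] that by simp
    have "Lam_elt p \<in> elts t" "Param_elt p \<in> elts t" using that by (auto simp: elts_def)
    then show "f (Param_elt p) = v (e (walk r p))" "f (Body_elt p) = v (v (e (walk r p)))"
      using v[of "Lam_elt p"] v[of "Param_elt p"] c by auto
  qed
  have rec: "f (receiver p) = walk r p" if "subterm_at t p \<noteq> None" for p
    using that
  proof (induction p rule: rev_induct)
    case Nil
    then show ?case using iso by (simp add: rtmap_iso_def underlying_map_def)
  next
    case (snoc d p)
    then have IH: "f (receiver p) = walk r p" by (auto simp: subterm_at_append split: option.splits)
    from snoc.prems consider "is_app_at t p" "d = Fun_dir \<or> d = Arg_dir" | "is_lam_at t p" "d = Body_dir"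
      by (auto simp: subterm_at_snoc[unfolded not_None_eq])
    then show ?case using app[OF _ IH] lam[OF _ IH] by cases (auto simp: walk_append)
  qed
  have "subterm_at t p \<noteq> None" if "is_app_at t p \<or> is_lam_at t p" for p
    using that by (auto simp: is_app_at_def is_lam_at_def)
  then show ?thesis using z app[OF _ rec] lam[OF _ rec] rec[of "[]"]
    by (cases z) (auto simp: elts_def)
qed

lemma iso_decodes:
  assumes lin: "linear \<Gamma> t" and iso: "rtmap_iso (underlying_map \<Gamma> t) M f"
  obtains \<rho> where "decodes \<rho> r t" "fresh {r} r t" "map \<rho> \<Gamma> = boundary M"
proof -
  have once: "uses_once t" and \<Gamma>: "set \<Gamma> = fv t" using lin by (auto simp: linear_iff)
  note pl = iso_place[OF once iso]
  have inj: "inj_on place (elts t)"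
    using iso pl by (auto simp: rtmap_iso_def underlying_map_def bij_betw_def inj_on_def)
  have e: "place (term_emap t z) = e (place z)" if "z \<in> elts t" for z
    using iso that pl term_emap_involution(1)[OF once that]
    by (auto simp: rtmap_iso_def underlying_map_def)
  define \<rho> where "\<rho> a = place (receiver (THE p. free_at t a p))" for a
  have "e (walk r p) = \<rho> a" if "free_at t a p" for a p
  proof -
    have "subterm_at t p \<noteq> None" using that by (simp add: free_at_def)
    then have "e (walk r p) = walk r p"
      using e[OF receiver_elts, of p] term_emap_free[OF that] by (simp add: place_receiver)
    moreover have "(THE p. free_at t a p) = p"
      using free_at_unique[OF once] that by (intro the_equality) auto
    ultimately show ?thesis by (simp add: \<rho>_def place_receiver)
  qed
  moreover have "e (walk r p) = v (e (walk r q))" if "binds t q a p" for a p q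
    using e[OF receiver_elts, of p] produces_subterm[OF produces.var[OF that]]
      term_emap_produces(2)[OF once produces.var[OF that]] by (simp add: place_receiver)
  ultimately have dec: "decodes \<rho> r t" unfolding decodes_iff by blast
  have fr: "fresh {r} r t"
  \<comment> \<open>Everything follows from injectivity: the entering element at \<open>p\<close> is
    neither the root nor one of the three elements at a proper prefix of \<open>p\<close>.\<close>
  proof (rule fresh_paths)
    fix p assume p: "is_app_at t p \<or> is_lam_at t p"
    define z where "z = (if is_app_at t p then Cont_elt p else Lam_elt p)"
    have z: "z \<in> elts t" "place z = e (walk r p)" using p by (auto simp: z_def elts_def)
    have "e (walk r p) \<noteq> r"
      using z inj_onD[OF inj, of z Root_elt] by (auto simp: z_def elts_def split: if_splits)
    moreover have "e (walk r p) \<notin> triple (e (walk r q))" if q: "strict_prefix q p" for q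
    proof -
      obtain d p' where "p = q @ d # p'"
        using q by (metis strict_prefix_def prefix_def append_Nil2 neq_Nil_conv)
      moreover have "subterm_at t p \<noteq> None" using p by (auto simp: is_app_at_def is_lam_at_def)
      ultimately have "subterm_at t (q @ [d]) \<noteq> None"
        using subterm_at_append[of t "q @ [d]" p'] by (auto split: option.splits)
      then have "is_app_at t q \<or> is_lam_at t q" by (auto simp: subterm_at_snoc[unfolded not_None_eq])
      then obtain Z where Z: "Z \<subseteq> elts t" "place ` Z = triple (e (walk r q))" "z \<notin> Z"
      proof
        assume "is_app_at t q"
        then show thesis using q
          by (intro that[of "{Cont_elt q, Arg_elt q, Fun_elt q}"]) (auto simp: elts_def triple_def z_def)
      next
        assume "is_lam_at t q"
        then show thesis using q
          by (intro that[of "{Lam_elt q, Param_elt q, Body_elt q}"]) (auto simp: elts_def triple_def z_def)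
      qed
      have "place z \<notin> place ` Z"
        using inj_on_image_mem_iff[OF inj z(1) Z(1)] Z(3) by simp
      then show ?thesis unfolding Z(2) z(2) .
    qed
    ultimately show "e (walk r p) \<notin> {r} \<and>
      (\<forall>q. strict_prefix q p \<longrightarrow> e (walk r p) \<notin> triple (e (walk r q)))" by blast
  qed
  have "f (receiver (THE p. free_at t a p)) = \<rho> a" if "a \<in> set \<Gamma>" for a
  proof -
    have "free_at t a (THE p. free_at t a p)" using free_at_The once \<Gamma> that by auto
    then have "receiver (THE p. free_at t a p) \<in> elts t"
      by (intro receiver_elts) (simp add: free_at_def)
    then show ?thesis by (simp add: \<rho>_def pl)
  qed
  then have "map (\<lambda>a. f (receiver (THE p. free_at t a p))) \<Gamma> = map \<rho> \<Gamma>"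
    by (intro map_cong) auto
  moreover have "map (\<lambda>a. f (receiver (THE p. free_at t a p))) \<Gamma> = boundary M"
    using iso by (simp add: rtmap_iso_def underlying_map_def comp_def)
  ultimately have "map \<rho> \<Gamma> = boundary M" by (simp only:)
  with dec fr show ?thesis using that by blast
qed

section \<open>Orbits of \<open>v\<close> and the number of elements\<close>

lemma carrier_decomposition: "A = insert r (\<Union>(trivalent_vertices M))"
  and root_not_in: "r \<notin> \<Union>(trivalent_vertices M)"
  and disjoint_vertices: "V \<in> trivalent_vertices M \<Longrightarrow> W \<in> trivalent_vertices M \<Longrightarrow> V \<noteq> W \<Longrightarrow> V \<inter> W = {}"
proof -
  have range: "range (\<lambda>i. (v ^^ i) x) = triple x" if "x \<in> A" for x
  proof -
    have "(v ^^ i) x \<in> triple x" for i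
      by (induction i) (use that in \<open>auto simp: triple_def\<close>)
    moreover have "(v ^^ 0) x = x" "(v ^^ 1) x = v x" "(v ^^ 2) x = v (v x)"
      by (simp_all add: numeral_2_eq_2)
    then have "triple x \<subseteq> range (\<lambda>i. (v ^^ i) x)" unfolding triple_def by (metis empty_subsetI insert_subset rangeI)
    ultimately show ?thesis by blast
  qed
  \<comment> \<open>As \<open>v\<close> has order three, any coincidence among \<open>x\<close>,
    \<open>v x\<close>, \<open>v (v x)\<close> forces \<open>v x = x\<close>, hence
    \<open>x = r\<close>.\<close>
  have card: "card (triple x) = 3 \<longleftrightarrow> x \<noteq> r" if "x \<in> A" for x
  proof
    assume "x \<noteq> r"
    then have "x \<noteq> v x" "v x \<noteq> v (v x)" "x \<noteq> v (v x)"
      using that v_fixed_root v_cube[of x] by (metis, metis, metis)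
    then show "card (triple x) = 3" by (simp add: triple_def)
  qed (auto simp: triple_def)
  have tv: "trivalent_vertices M = triple ` (A - {r})"
    unfolding trivalent_vertices_def using range card by auto
  have triple_eq: "triple y = triple x" if "x \<in> A" "y \<in> triple x" for x y
    using that by (auto simp: triple_def)
  have "triple x \<subseteq> A" "x \<in> triple x" if "x \<in> A" for x using that by (auto simp: triple_def)
  then show "A = insert r (\<Union>(trivalent_vertices M))" unfolding tv by auto
  show "r \<notin> \<Union>(trivalent_vertices M)"
  proof
    assume "r \<in> \<Union>(trivalent_vertices M)"
    then obtain x where "x \<in> A" "x \<noteq> r" "r \<in> triple x" by (auto simp: tv)
    then show False using triple_eq[of x r] card[of x] by (simp add: triple_def)
  qed
  show "V \<in> trivalent_vertices M \<Longrightarrow> W \<in> trivalent_vertices M \<Longrightarrow> V \<noteq> W \<Longrightarrow> V \<inter> W = {}"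
    unfolding tv using triple_eq by (smt (verit) DiffD1 disjoint_iff image_iff)
qed

lemma card_carrier:
  assumes "finite (trivalent_vertices M)"
  shows "finite A" "card A = 1 + 3 * card (trivalent_vertices M)"
proof -
  have 3: "card V = 3" if "V \<in> trivalent_vertices M" for V
    using that by (auto simp: trivalent_vertices_def)
  then have fin: "finite V" if "V \<in> trivalent_vertices M" for V
    using that by (metis card.infinite zero_neq_numeral)
  show "finite A" unfolding carrier_decomposition using assms fin by auto
  have "card (\<Union>(trivalent_vertices M)) = (\<Sum>V\<in>trivalent_vertices M. card V)"
    using fin disjoint_vertices by (intro card_Union_disjoint) (auto simp: pairwise_def disjnt_def)
  also have "\<dots> = 3 * card (trivalent_vertices M)" using 3 by simp
  finally show "card A = 1 + 3 * card (trivalent_vertices M)"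
    unfolding carrier_decomposition using root_not_in assms fin by (subst card_insert_disjoint) auto
qed

section \<open>Existence\<close>

text \<open>The component of \<open>x\<close> once the vertices in \<open>U\<close> have been cut apart: their elements
  remain as loose ends.\<close>

inductive_set conn :: "'a set \<Rightarrow> 'a \<Rightarrow> 'a set" for U x where
  start: "x \<in> conn U x"
| edge: "y \<in> conn U x \<Longrightarrow> e y \<in> conn U x"
| vertex: "y \<in> conn U x \<Longrightarrow> y \<notin> U \<Longrightarrow> v y \<in> conn U x"

lemma conn_least:
  assumes "x \<in> S" "\<And>y. y \<in> S \<Longrightarrow> e y \<in> S" "\<And>y. y \<in> S \<Longrightarrow> y \<notin> U \<Longrightarrow> v y \<in> S"
  shows "conn U x \<subseteq> S"
proof
  fix y assume "y \<in> conn U x"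
  then show "y \<in> S" by induction (use assms in auto)
qed

lemma conn_trans: "y \<in> conn U x \<Longrightarrow> conn U y \<subseteq> conn U x"
  by (rule conn_least) (auto intro: conn.intros)

lemma conn_antimono: "U \<subseteq> U' \<Longrightarrow> conn U' x \<subseteq> conn U x"
  by (rule conn_least) (auto intro: conn.intros)

lemma conn_in: "x \<in> A \<Longrightarrow> conn U x \<subseteq> A"
  by (rule conn_least) auto

text \<open>Since \<open>v\<close> has order three, such a \<open>U\<close> is a union of orbits:
  vertices are cut as a whole, never at some of their elements only.\<close>

definition v_closed :: "'a set \<Rightarrow> bool" where
  "v_closed U \<longleftrightarrow> U \<subseteq> A \<and> (\<forall>y\<in>U. v y \<in> U)"

lemma v_closed_iff: "v_closed U \<Longrightarrow> y \<in> A \<Longrightarrow> v y \<in> U \<longleftrightarrow> y \<in> U"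
  unfolding v_closed_def using v_cube by metis

lemma v_closed_triple: "v_closed U \<Longrightarrow> z \<in> A \<Longrightarrow> v_closed (U \<union> triple z)"
  by (auto simp: v_closed_def triple_def)

text \<open>A move by \<open>v\<close> made outside \<open>U\<close> stays outside \<open>U\<close>,
  so two more such moves lead back.\<close>

lemma conn_sym:
  assumes "v_closed U" "x \<in> A" "y \<in> conn U x"
  shows "x \<in> conn U y"
  using assms(3)
proof induction
  case start
  show ?case by (rule conn.start)
next
  case (edge y)
  have "y \<in> A" using edge conn_in assms(2) by blast
  then have "y \<in> conn U (e y)" using conn.edge[OF conn.start, of "e y" U] by simp
  then show ?case using edge conn_trans by blast
next
  case (vertex y)
  have y: "y \<in> A" using vertex conn_in assms(2) by blast
  have "v y \<notin> U" "v (v y) \<notin> U" using v_closed_iff[OF assms(1)] y vertex by simp_all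
  then have "v (v (v y)) \<in> conn U (v y)" by (intro conn.vertex conn.start)
  then have "y \<in> conn U (v y)" using y by simp
  then show ?case using vertex conn_trans by blast
qed

lemma triple_new:
  assumes "v_closed U" "r \<in> U" "z \<in> A" "z \<notin> U"
  shows "v z \<notin> U" "v (v z) \<notin> U" "v z \<noteq> z" "v (v z) \<noteq> z" "v (v z) \<noteq> v z"
proof -
  show "v z \<notin> U" "v (v z) \<notin> U" using v_closed_iff assms by simp_all
  show n: "v z \<noteq> z" using v_fixed_root assms by metis
  show "v (v z) \<noteq> z" "v (v z) \<noteq> v z" using n v_cube[OF assms(3)] by metis+
qed

text \<open>With \<open>x\<close> in \<open>U\<close> and the vertex of \<open>z\<close> cut as
  well, the edge between \<open>x\<close> and \<open>z\<close> is isolated: \<open>e\<close> swaps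
  its ends and no uncut vertex contains either. What remains of the component hangs on
  \<open>v z\<close> and \<open>v (v z)\<close>.\<close>

lemma conn_unfold:
  assumes U: "v_closed U" "r \<in> U" "x \<in> U" and z: "z = e x" "z \<notin> U"
  shows "conn U x = {x, z} \<union> conn (U \<union> triple z) (v (v z)) \<union> conn (U \<union> triple z) (v z)" (is "_ = ?R")
    and "conn (U \<union> triple z) (v (v z)) \<inter> {x, z} = {}" "conn (U \<union> triple z) (v z) \<inter> {x, z} = {}"
proof -
  have x: "x \<in> A" and zA: "z \<in> A" using U z by (auto simp: v_closed_def)
  have ez: "e z = x" using z x by simp
  note new = triple_new[OF U(1,2) zA z(2)]
  have zc: "z \<in> conn U x" using z conn.edge conn.start by metis
  then have "v z \<in> conn U x" using z conn.vertex by blast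
  moreover from this have "v (v z) \<in> conn U x" using new conn.vertex by blast
  ultimately have "?R \<subseteq> conn U x"
    using zc conn.start[of x U] conn_antimono[of U "U \<union> triple z"] conn_trans[of _ U x] by blast
  moreover have "conn U x \<subseteq> ?R"
  proof (rule conn_least)
    fix y assume y: "y \<in> ?R"
    then show "e y \<in> ?R" using ez z by (auto intro: conn.edge)
    assume "y \<notin> U"
    show "v y \<in> ?R"
    proof (cases "y \<in> triple z")
      case True
      then show ?thesis using zA by (auto simp: triple_def intro: conn.start)
    next
      case False
      then show ?thesis using y U z \<open>y \<notin> U\<close> by (auto simp: triple_def intro: conn.vertex)
    qed
  qed simp
  ultimately show "conn U x = ?R" by blast
  have "conn (U \<union> triple z) y \<subseteq> A - {x, z}" if "y \<in> A - {x, z}" for y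
  proof (rule conn_least)
    fix y assume y: "y \<in> A - {x, z}"
    have "e y \<noteq> x" "e y \<noteq> z" using y ez z(1) e_e[of y] by (metis DiffE insertCI)+
    then show "e y \<in> A - {x, z}" using y by auto
    assume "y \<notin> U \<union> triple z"
    then have "v y \<notin> U \<union> triple z" using v_closed_iff[OF v_closed_triple[OF U(1) zA]] y by blast
    then show "v y \<in> A - {x, z}" using y U by (auto simp: triple_def)
  qed fact
  moreover have "v z \<in> A - {x, z}" "v (v z) \<in> A - {x, z}" using new U zA by auto
  ultimately show "conn (U \<union> triple z) (v (v z)) \<inter> {x, z} = {}" "conn (U \<union> triple z) (v z) \<inter> {x, z} = {}"
    by blast+
qed

text \<open>The loose ends of a component other than its root \<open>x\<close>; \<open>x\<close> itself counts when it is a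
  boundary element, the component then being a single free variable.\<close>

definition ends :: "'a set \<Rightarrow> 'a \<Rightarrow> 'a set" where
  "ends U x = {w \<in> conn U x. e w = w \<or> w \<in> U \<and> w \<noteq> x}"

text \<open>Prescribing the free variables as names of the loose ends makes linearity readable off
  the map: disjoint components give disjoint variables, and a parameter that is a loose end of the
  body is free in it.\<close>

lemma decode_exists:
  assumes "finite A" "inj_on nm A" "\<And>y. y \<in> A \<Longrightarrow> \<rho> (nm y) = y"
  shows "v_closed U \<Longrightarrow> r \<in> U \<Longrightarrow> x \<in> U \<Longrightarrow>
    \<exists>t. decodes \<rho> x t \<and> fresh U x t \<and> uses_once t \<and> fv t = nm ` ends U x"
proof (induction "card (A - U)" arbitrary: U x rule: less_induct)
  case less
  have x: "x \<in> A" using less.prems by (auto simp: v_closed_def)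
  define z where "z = e x"
  have z: "z \<in> A" "e z = x" using x by (simp_all add: z_def)
  show ?case
  proof (cases "z \<in> U")
    case True
    \<comment> \<open>Both ends of the edge are cut, so it is the whole component. It is degenerate,
      with \<open>z = x\<close>, when \<open>x\<close> is a boundary element.\<close>
    have "conn U x \<subseteq> {x, z}" by (rule conn_least) (use True less.prems z in \<open>auto simp: z_def\<close>)
    then have "conn U x = {x, z}" using conn.start conn.edge unfolding z_def by blast
    then have "ends U x = {z}" using True z by (auto simp: ends_def z_def)
    then have "decodes \<rho> x (Var (nm z)) \<and> fresh U x (Var (nm z)) \<and> uses_once (Var (nm z)) \<and>
        fv (Var (nm z)) = nm ` ends U x"
      using assms(3) z by (simp add: z_def)
    then show ?thesis by blast
  next
    case False
    define V where "V = U \<union> triple z"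
    define B where "B = conn V (v (v z))"
    define C where "C = conn V (v z)"
    note new = triple_new[OF less.prems(1,2) z(1) False]
    note unf = conn_unfold[OF less.prems z_def False, folded V_def, folded B_def C_def]
    have BA: "B \<subseteq> A" "C \<subseteq> A" unfolding B_def C_def using z by (auto intro!: conn_in)
    have start: "v (v z) \<in> B" "v z \<in> C" unfolding B_def C_def by (simp_all add: conn.start)
    have V: "v_closed V" "r \<in> V" "v (v z) \<in> V" "v z \<in> V" "z \<in> V"
      unfolding V_def using v_closed_triple less.prems z by (auto simp: triple_def)
    have "A - V \<subset> A - U" using False z unfolding V_def triple_def by blast
    then have "card (A - V) < card (A - U)" using assms(1) by (simp add: psubset_card_mono)
    note IH = less.hyps[OF this V(1,2)]
    obtain t where t: "decodes \<rho> (v (v z)) t" "fresh V (v (v z)) t" "uses_once t"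
        "fv t = nm ` ends V (v (v z))"
      using IH[OF V(3)] by blast
    \<comment> \<open>The clause \<open>w \<noteq> x\<close> disappears because \<open>x\<close>
      lies in neither \<open>B\<close> nor \<open>C\<close>; \<open>z\<close> is no end, being
      neither fixed nor in \<open>U\<close>.\<close>
    have endsU: "ends U x = {w \<in> B \<union> C. e w = w \<or> w \<in> U}"
      unfolding ends_def unf(1) using False z unf(2,3) less.prems(3) by (auto simp: z_def)
    show ?thesis
    proof (cases "v z \<in> B")
      case True
      \<comment> \<open>A fixed \<open>v z\<close> would be a component by itself, yet by symmetry
        its component contains \<open>v (v z)\<close>.\<close>
      have "e (v z) \<noteq> v z"
      proof
        assume "e (v z) = v z"
        then have "C \<subseteq> {v z}" unfolding C_def using V by (intro conn_least) auto
        moreover have "v (v z) \<in> C"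
          using conn_sym[OF V(1), of "v (v z)" "v z"] True z unfolding B_def C_def by simp
        ultimately show False using new by blast
      qed
      moreover have "C \<subseteq> B" using conn_trans True unfolding B_def C_def by blast
      \<comment> \<open>Of the three newly cut elements, \<open>z\<close> lies outside
        \<open>B\<close> and \<open>v (v z)\<close> is the root of the component, so only
        \<open>v z\<close> is an additional end.\<close>
      ultimately have ends: "ends V (v (v z)) = insert (v z) (ends U x)" "v z \<notin> ends U x"
        unfolding endsU ends_def[of V] B_def[symmetric] using True new unf(2)
        by (auto simp: V_def triple_def)
      have "nm (v z) \<notin> nm ` ends U x"
        using ends(2) assms(2) z BA endsU by (auto dest!: inj_onD)
      then have "fv (Lam (nm (v z)) t) = nm ` ends U x" "nm (v z) \<in> fv t"
        by (simp_all add: t ends)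
      \<comment> \<open>Names denote elements once and for all, so binding a parameter does not
        change \<rho>.\<close>
      moreover have "\<rho>(nm (v z) := v z) = \<rho>" using assms(3) z by auto
      ultimately have "decodes \<rho> x (Lam (nm (v z)) t) \<and> fresh U x (Lam (nm (v z)) t) \<and>
          uses_once (Lam (nm (v z)) t) \<and> fv (Lam (nm (v z)) t) = nm ` ends U x"
        using t(1-3) False by (simp add: z_def V_def)
      then show ?thesis by blast
    next
      case notin: False
      obtain u where u: "decodes \<rho> (v z) u" "fresh V (v z) u" "uses_once u" "fv u = nm ` ends V (v z)"
        using IH[OF V(4)] by blast
      have disj: "B \<inter> C = {}"
      proof (rule ccontr)
        assume "B \<inter> C \<noteq> {}"
        then obtain w where "w \<in> B" "w \<in> C" by blast
        then have "v z \<in> conn V w" using conn_sym[OF V(1)] z unfolding C_def by blast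
        then show False using \<open>w \<in> B\<close> notin conn_trans unfolding B_def by blast
      qed
      \<comment> \<open>Cutting the vertex adds no end here: each component contains just one of its
        elements, namely its own root.\<close>
      have "ends V (v (v z)) = {w \<in> B. e w = w \<or> w \<in> U}" "ends V (v z) = {w \<in> C. e w = w \<or> w \<in> U}"
        unfolding ends_def B_def[symmetric] C_def[symmetric]
        using disj start unf(2,3) new by (auto simp: V_def triple_def)
      then have "ends U x = ends V (v (v z)) \<union> ends V (v z)" "ends V (v (v z)) \<inter> ends V (v z) = {}"
        "ends V (v (v z)) \<subseteq> A" "ends V (v z) \<subseteq> A"
        using disj BA endsU by auto
      then have "fv t \<inter> fv u = {}" "fv (App t u) = nm ` ends U x"
        using t u assms(2) by (simp_all add: image_Un flip: inj_on_image_Int)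
      then have "decodes \<rho> x (App t u) \<and> fresh U x (App t u) \<and> uses_once (App t u) \<and>
          fv (App t u) = nm ` ends U x"
        using t u False by (simp add: z_def V_def)
      then show ?thesis by blast
    qed
  qed
qed

lemma term_exists:
  assumes "finite A" "inj_on nm A"
  obtains t where "linear (map nm (boundary M)) t"
    "rtmap_iso (underlying_map (map nm (boundary M)) t) M place"
proof -
  let ?\<rho> = "inv_into A nm"
  have \<rho>: "?\<rho> (nm y) = y" if "y \<in> A" for y using assms(2) that by simp
  \<comment> \<open>Cutting at \<open>r\<close> loses nothing since \<open>v r = r\<close>: the
    component is the whole carrier, and its ends are the fixed points of \<open>e\<close>.\<close>
  obtain t where t: "decodes ?\<rho> r t" "fresh {r} r t" "uses_once t" "fv t = nm ` ends {r} r"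
    using decode_exists[OF assms \<rho>, of "{r}" r] by (auto simp: v_closed_def)
  have "y \<in> conn {r} x" if "reachable M x y" "x = r" for x y
    using that
  proof (induction rule: reachable.induct)
    case (vmap x y)
    then show ?case by (cases "y = r") (auto intro: conn.intros)
  qed (auto intro: conn.intros)
  then have "A \<subseteq> conn {r} r" using reach[OF r_in] by blast
  then have "conn {r} r = A" using conn_in[OF r_in, of "{r}"] by blast
  then have "ends {r} r = {w \<in> A. e w = w}" unfolding ends_def by blast
  then have "ends {r} r = set (boundary M)" by (simp only: e_fixed)
  moreover have bA: "set (boundary M) \<subseteq> A" using boundary_in by blast
  ultimately have lin: "linear (map nm (boundary M)) t"
    using t distinct_boundary assms(2) by (auto simp: linear_iff distinct_map inj_on_subset)
  moreover have "map ?\<rho> (map nm (boundary M)) = boundary M"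
    using \<rho> bA by (auto intro!: map_idI)
  ultimately show ?thesis using that decodes_iso t by blast
qed

section \<open>Uniqueness\<close>

lemma decodes_cong: "(\<And>a. a \<in> fv t \<Longrightarrow> \<rho> a = \<rho>' a) \<Longrightarrow> decodes \<rho> x t \<longleftrightarrow> decodes \<rho>' x t"
proof (induction t arbitrary: \<rho> \<rho>' x)
  case (App t u)
  have "decodes \<rho> y t \<longleftrightarrow> decodes \<rho>' y t" "decodes \<rho> y u \<longleftrightarrow> decodes \<rho>' y u" for y
    using App.prems by (auto intro!: App.IH)
  then show ?case by simp
next
  case (Lam a t)
  have "decodes (\<rho>(a := w)) y t \<longleftrightarrow> decodes (\<rho>'(a := w)) y t" for y w
    using Lam.prems by (intro Lam.IH) auto
  then show ?case by simp
qed simp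

lemma decodes_rename:
  "b \<notin> vars t \<Longrightarrow> decodes (\<rho>(b := \<rho> a)) x (rename a b t) \<longleftrightarrow> decodes \<rho> x t"
proof (induction t arbitrary: \<rho> x)
  case (Lam c t)
  show ?case
  proof (cases "c = a")
    case True
    have eq: "decodes (\<rho>(b := \<rho> a, a := w)) y t \<longleftrightarrow> decodes (\<rho>(a := w)) y t" for w y
      using Lam.prems fv_subset_vars[of t] by (intro decodes_cong) auto
    show ?thesis by (simp only: True rename.simps HOL.refl if_True decodes.simps eq)
  next
    case False
    have upd: "(\<rho>(c := w))(b := (\<rho>(c := w)) a) = \<rho>(b := \<rho> a, c := w)" for w
      using Lam.prems False by auto
    have "b \<notin> vars t" using Lam.prems by simp
    note eq = Lam.IH[OF this, of "\<rho>(c := _)", unfolded upd]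
    show ?thesis by (simp only: False rename.simps if_False decodes.simps eq)
  qed
qed auto

text \<open>The value of a bound name is set by its abstraction to \<open>v (e x)\<close>, whatever
  the name is.\<close>

lemma bound_change_decodes: "bound_change t t' \<Longrightarrow> decodes \<rho> x t \<longleftrightarrow> decodes \<rho> x t'"
proof (induction arbitrary: \<rho> x rule: bound_change.induct)
  case (here b u a)
  have "decodes (\<rho>(a := w)) y u \<longleftrightarrow> decodes (\<rho>(b := w)) y (rename a b u)" for w y
  proof -
    have "decodes (\<rho>(a := w, b := w)) y (rename a b u) \<longleftrightarrow> decodes (\<rho>(a := w)) y u"
      using decodes_rename[OF here, of "\<rho>(a := w)" a y] by simp
    moreover have "decodes (\<rho>(a := w, b := w)) y (rename a b u) \<longleftrightarrow> decodes (\<rho>(b := w)) y (rename a b u)"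
      using here by (intro decodes_cong) (auto simp: fv_rename split: if_splits)
    ultimately show ?thesis by simp
  qed
  then show ?case by simp
qed auto

text \<open>The shape of the term is forced by the map: a vertex is an application if cutting it apart
  separates its two lower ends, and an abstraction otherwise. The condition
  \<open>e (v (e x)) \<noteq> v (e x)\<close> keeps parameters off the boundary, so that fresh names chosen for
  both are different.\<close>

fun tight :: "'a set \<Rightarrow> 'a \<Rightarrow> trm \<Rightarrow> bool" where
  "tight U x (Var a) \<longleftrightarrow> e x \<in> U"
| "tight U x (App t u) \<longleftrightarrow> e x \<notin> U \<and>
    v (e x) \<notin> conn (U \<union> triple (e x)) (v (v (e x))) \<and>
    tight (U \<union> triple (e x)) (v (v (e x))) t \<and> tight (U \<union> triple (e x)) (v (e x)) u"
| "tight U x (Lam a t) \<longleftrightarrow> e x \<notin> U \<and>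
    v (e x) \<in> conn (U \<union> triple (e x)) (v (v (e x))) \<and> e (v (e x)) \<noteq> v (e x) \<and>
    tight (U \<union> triple (e x)) (v (v (e x))) t"

text \<open>Only bound names are prescribed. Free ones are controlled by
  \<open>nm (\<rho> a) = a\<close>, so the two kinds can be normalised separately.\<close>

fun named :: "('a \<Rightarrow> nat) \<Rightarrow> 'a \<Rightarrow> trm \<Rightarrow> bool" where
  "named nm x (Var a) \<longleftrightarrow> True"
| "named nm x (App t u) \<longleftrightarrow> named nm (v (v (e x))) t \<and> named nm (v (e x)) u"
| "named nm x (Lam a t) \<longleftrightarrow> a = nm (v (e x)) \<and> named nm (v (v (e x))) t"

fun params :: "'a \<Rightarrow> trm \<Rightarrow> 'a set" where
  "params x (Var a) = {}"
| "params x (App t u) = params (v (v (e x))) t \<union> params (v (e x)) u"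
| "params x (Lam a t) = insert (v (e x)) (params (v (v (e x))) t)"

fun verts :: "'a \<Rightarrow> trm \<Rightarrow> 'a set" where
  "verts x (Var a) = {}"
| "verts x (App t u) = triple (e x) \<union> verts (v (v (e x))) t \<union> verts (v (e x)) u"
| "verts x (Lam a t) = triple (e x) \<union> verts (v (v (e x))) t"

lemma tight_rename: "tight U x (rename a b t) \<longleftrightarrow> tight U x t"
  by (induction t arbitrary: U x) auto

lemma named_rename: "named nm x (rename a b t) \<longleftrightarrow> named nm x t"
  by (induction t arbitrary: x) auto

lemma bound_change_tight: "bound_change t t' \<Longrightarrow> tight U x t \<longleftrightarrow> tight U x t'"
  by (induction arbitrary: U x rule: bound_change.induct) (auto simp: tight_rename)

text \<open>The conditions in \<open>tight\<close> for the three constructors exclude one another,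
  which fixes the shape. Bound names are fixed by \<open>named\<close>, and a variable received at
  \<open>x\<close> must be the name of \<open>e x\<close>.\<close>

lemma tight_unique:
  assumes "tight U x s" "tight U x t" "decodes \<rho> x s" "decodes \<sigma> x t" "named nm x s" "named nm x t"
    "\<And>a. a \<in> fv s \<Longrightarrow> nm (\<rho> a) = a" "\<And>a. a \<in> fv t \<Longrightarrow> nm (\<sigma> a) = a"
  shows "s = t"
  using assms
proof (induction s arbitrary: t U x \<rho> \<sigma>)
  case (Var a)
  then show ?case by (cases t) auto
next
  case (App s1 s2)
  then obtain t1 t2 where t: "t = App t1 t2" by (cases t) auto
  have "s1 = t1" by (rule App.IH(1)) (use App.prems in \<open>auto simp: t\<close>)
  moreover have "s2 = t2" by (rule App.IH(2)) (use App.prems in \<open>auto simp: t\<close>)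
  ultimately show ?case by (simp add: t)
next
  case (Lam a s')
  then obtain b t' where t: "t = Lam b t'" by (cases t) auto
  have "s' = t'" by (rule Lam.IH) (use Lam.prems in \<open>auto simp: t\<close>)
  then show ?case using Lam.prems by (simp add: t)
qed

section \<open>Elements met by a term and connectivity after cutting\<close>

lemma fresh_verts: "fresh U x s \<Longrightarrow> v_closed U \<Longrightarrow> x \<in> A \<Longrightarrow> verts x s \<inter> U = {}"
proof (induction s arbitrary: x)
  case (App t u)
  have "triple (e x) \<inter> U = {}"
    using App.prems v_closed_iff[OF App.prems(2)] by (auto simp: triple_def)
  moreover have "fresh U (v (v (e x))) t" "fresh U (v (e x)) u"
    using App.prems(1) by (auto intro: fresh_antimono)
  moreover have "v (v (e x)) \<in> A" "v (e x) \<in> A" using App.prems by simp_all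
  ultimately show ?case
    using App.IH(1)[OF _ App.prems(2), of "v (v (e x))"] App.IH(2)[OF _ App.prems(2), of "v (e x)"]
    unfolding verts.simps by blast
next
  case (Lam a t)
  have "triple (e x) \<inter> U = {}"
    using Lam.prems v_closed_iff[OF Lam.prems(2)] by (auto simp: triple_def)
  moreover have "fresh U (v (v (e x))) t"
    using Lam.prems(1) by (auto intro: fresh_antimono)
  moreover have "v (v (e x)) \<in> A" using Lam.prems by simp
  ultimately show ?case
    using Lam.IH[OF _ Lam.prems(2), of "v (v (e x))"] unfolding verts.simps by blast
qed simp

lemma v_verts: "x \<in> A \<Longrightarrow> y \<in> verts x s \<Longrightarrow> v y \<in> verts x s"
  by (induction s arbitrary: x) (auto simp: triple_def)

text \<open>Each edge joins a receiving element to its producer. At an abstraction, linearity makes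
  the parameter element the producer of a variable free in the body, so its edge stays inside the
  hull.\<close>

lemma e_hull:
  "decodes \<rho> x s \<Longrightarrow> uses_once s \<Longrightarrow> x \<in> A \<Longrightarrow>
    y \<in> insert x (verts x s \<union> \<rho> ` fv s) \<Longrightarrow> e y \<in> insert x (verts x s \<union> \<rho> ` fv s)"
proof (induction s arbitrary: x y \<rho>)
  case (Var a)
  then show ?case by auto
next
  case (App t u)
  define z where "z = e x"
  have z: "z \<in> A" "e z = x" using App.prems by (simp_all add: z_def)
  let ?T = "insert (v (v z)) (verts (v (v z)) t \<union> \<rho> ` fv t)"
  let ?U = "insert (v z) (verts (v z) u \<union> \<rho> ` fv u)"
  have eq: "insert x (verts x (App t u) \<union> \<rho> ` fv (App t u)) = {x, z} \<union> ?T \<union> ?U"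
    by (auto simp: z_def triple_def)
  have T: "y \<in> ?T \<Longrightarrow> e y \<in> ?T"
    by (rule App.IH(1)) (use App.prems z in \<open>simp_all add: z_def\<close>)
  have U: "y \<in> ?U \<Longrightarrow> e y \<in> ?U"
    by (rule App.IH(2)) (use App.prems z in \<open>simp_all add: z_def\<close>)
  have cases: "e y \<in> {x, z} \<union> T \<union> U"
    if "y \<in> {x, z} \<union> T \<union> U" "y \<in> T \<Longrightarrow> e y \<in> T" "y \<in> U \<Longrightarrow> e y \<in> U" for T U
    using that z(2) z_def by auto
  show ?case using App.prems(4) unfolding eq by (rule cases[OF _ T U])
next
  case (Lam a t)
  define z where "z = e x"
  have z: "z \<in> A" "e z = x" using Lam.prems by (simp_all add: z_def)
  let ?\<rho> = "\<rho>(a := v z)"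
  let ?T = "insert (v (v z)) (verts (v (v z)) t \<union> ?\<rho> ` fv t)"
  have "?\<rho> ` fv t = insert (v z) (\<rho> ` (fv t - {a}))"
    using Lam.prems(2) by auto
  then have eq: "insert x (verts x (Lam a t) \<union> \<rho> ` fv (Lam a t)) = {x, z} \<union> ?T"
    by (auto simp: z_def triple_def)
  have t: "decodes ?\<rho> (v (v z)) t" "uses_once t" "v (v z) \<in> A"
    using Lam.prems(1,2) z by (simp_all add: z_def)
  have T: "y \<in> ?T \<Longrightarrow> e y \<in> ?T"
    by (rule Lam.IH[OF t])
  have cases: "e y \<in> {x, z} \<union> T" if "y \<in> {x, z} \<union> T" "y \<in> T \<Longrightarrow> e y \<in> T" for T
    using that z(2) z_def by auto
  show ?case using Lam.prems(4) unfolding eq by (rule cases[OF _ T])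
qed

text \<open>A producer fixed by \<open>e\<close> coincides with the receiving element of the
  occurrence, which is \<open>x\<close> or belongs to a vertex of the term.\<close>

lemma fixed_in_hull:
  "decodes \<rho> x s \<Longrightarrow> x \<in> A \<Longrightarrow> a \<in> fv s \<Longrightarrow> e (\<rho> a) = \<rho> a \<Longrightarrow> \<rho> a \<in> insert x (verts x s)"
proof (induction s arbitrary: x \<rho>)
  case (Var b)
  then show ?case by simp
next
  case (App t u)
  from App.prems(3) consider "a \<in> fv t" | "a \<in> fv u" by auto
  then show ?case
  proof cases
    case 1
    then show ?thesis using App.IH(1)[of \<rho> "v (v (e x))"] App.prems by (auto simp: triple_def)
  next
    case 2
    then show ?thesis using App.IH(2)[of \<rho> "v (e x)"] App.prems by (auto simp: triple_def)
  qed
next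
  case (Lam b t)
  then have "a \<noteq> b" "a \<in> fv t" and dec: "decodes (\<rho>(b := v (e x))) (v (v (e x))) t" by simp_all
  then show ?case using Lam.IH[OF dec] Lam.prems by (auto simp: triple_def)
qed

text \<open>The descent to the occurrence of \<open>a\<close> is a path for \<open>conn\<close>,
  since by \<open>fresh\<close> it passes through no vertex cut before.\<close>

lemma fv_in_conn:
  "decodes \<rho> x s \<Longrightarrow> fresh U x s \<Longrightarrow> v_closed U \<Longrightarrow> x \<in> A \<Longrightarrow> a \<in> fv s \<Longrightarrow> \<rho> a \<in> conn U x"
proof (induction s arbitrary: x \<rho> U)
  case (Var b)
  then show ?case using conn.edge[OF conn.start, of x U] by simp
next
  case (App t u)
  let ?U = "U \<union> triple (e x)"
  have U: "v_closed ?U" using App.prems v_closed_triple by simp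
  have "e x \<in> conn U x" by (intro conn.edge conn.start)
  moreover have "e x \<notin> U" "v (e x) \<notin> U" using App.prems v_closed_iff by simp_all
  ultimately have "v (e x) \<in> conn U x" "v (v (e x)) \<in> conn U x" by (auto intro: conn.vertex)
  then have sub: "conn ?U (v (e x)) \<subseteq> conn U x" "conn ?U (v (v (e x))) \<subseteq> conn U x"
    using conn_trans conn_antimono[of U ?U] by blast+
  from App.prems(5) consider "a \<in> fv t" | "a \<in> fv u" by auto
  then show ?case
  proof cases
    case 1
    then show ?thesis using App.IH(1)[of \<rho> "v (v (e x))" ?U] App.prems U sub by auto
  next
    case 2
    then show ?thesis using App.IH(2)[of \<rho> "v (e x)" ?U] App.prems U sub by auto
  qed
next
  case (Lam b t)
  let ?U = "U \<union> triple (e x)"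
  have U: "v_closed ?U" using Lam.prems v_closed_triple by simp
  have "e x \<in> conn U x" by (intro conn.edge conn.start)
  moreover have "e x \<notin> U" "v (e x) \<notin> U" using Lam.prems v_closed_iff by simp_all
  ultimately have "v (e x) \<in> conn U x" "v (v (e x)) \<in> conn U x" by (auto intro: conn.vertex)
  then have "conn ?U (v (v (e x))) \<subseteq> conn U x"
    using conn_trans conn_antimono[of U ?U] by blast
  moreover have "a \<noteq> b" "a \<in> fv t" and dec: "decodes (\<rho>(b := v (e x))) (v (v (e x))) t"
    using Lam.prems by simp_all
  ultimately show ?case using Lam.IH[OF dec _ U] Lam.prems by auto
qed

text \<open>For an application, the elements met by the function part together with the producers of its
  free variables are closed under the moves of \<open>conn\<close>, and the argument element is not
  among them. For an abstraction, the occurrence of the bound variable connects parameter and body.\<close>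

lemma decodes_tight:
  "decodes \<rho> x s \<Longrightarrow> fresh U x s \<Longrightarrow> uses_once s \<Longrightarrow> v_closed U \<Longrightarrow> r \<in> U \<Longrightarrow> x \<in> U \<Longrightarrow>
    (\<And>a. a \<in> fv s \<Longrightarrow> \<rho> a \<in> U \<or> e (\<rho> a) = \<rho> a) \<Longrightarrow> tight U x s"
proof (induction s arbitrary: x \<rho> U)
  case (Var a)
  have "x \<in> A" using Var by (auto simp: v_closed_def)
  then show ?case using Var.prems(1,6,7) by auto
next
  case (App t u)
  define z where "z = e x"
  let ?U = "U \<union> triple z"
  have x: "x \<in> A" using App.prems by (auto simp: v_closed_def)
  have z: "z \<in> A" "z \<notin> U" using x App.prems by (simp_all add: z_def)
  note new = triple_new[OF App.prems(4,5) z]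
  have U: "v_closed ?U" "r \<in> ?U" "v (v z) \<in> ?U" "v z \<in> ?U"
    using v_closed_triple App.prems z by (auto simp: triple_def)
  have ends: "\<rho> a \<in> U \<or> e (\<rho> a) = \<rho> a" if "a \<in> fv t \<union> fv u" for a using App.prems(7) that by simp
  have t: "decodes \<rho> (v (v z)) t" "fresh ?U (v (v z)) t" "uses_once t"
    and u: "decodes \<rho> (v z) u" "fresh ?U (v z) u" "uses_once u"
    using App.prems by (simp_all add: z_def)
  have "tight ?U (v (v z)) t" by (rule App.IH(1)[OF t U(1,2,3)]) (use ends in auto)
  moreover have "tight ?U (v z) u" by (rule App.IH(2)[OF u U(1,2,4)]) (use ends in auto)
  moreover have "v z \<notin> conn ?U (v (v z))"
  proof -
    have vs: "verts (v (v z)) t \<inter> ?U = {}" using fresh_verts[OF t(2) U(1)] z by simp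
    \<comment> \<open>A producer outside \<open>U\<close> is a boundary element, hence already met
      by the term; so \<open>v\<close> can only be applied at elements of
      \<open>verts\<close>.\<close>
    have fx: "\<rho> a \<in> U \<or> \<rho> a \<in> insert (v (v z)) (verts (v (v z)) t)" if "a \<in> fv t" for a
      using ends[of a] fixed_in_hull[OF t(1)] z that by auto
    let ?T = "insert (v (v z)) (verts (v (v z)) t \<union> \<rho> ` fv t)"
    have "conn ?U (v (v z)) \<subseteq> ?T"
    proof (rule conn_least)
      fix y assume y: "y \<in> ?T"
      show "e y \<in> ?T" by (rule e_hull[OF t(1,3) _ y]) (use z in simp)
      assume "y \<notin> ?U"
      then have "y \<in> verts (v (v z)) t" using y fx U(3) by (metis UnE UnI1 imageE insertE)
      then show "v y \<in> ?T" using v_verts z by simp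
    qed simp
    moreover have "v z \<notin> ?T" using vs fx new U(4) by (metis (no_types, lifting) IntI UnE empty_iff imageE insertE)
    ultimately show ?thesis by blast
  qed
  ultimately show ?case using z by (simp add: z_def)
next
  case (Lam a t)
  define z where "z = e x"
  let ?U = "U \<union> triple z" and ?\<rho> = "\<rho>(a := v z)"
  have x: "x \<in> A" using Lam.prems by (auto simp: v_closed_def)
  have z: "z \<in> A" "z \<notin> U" using x Lam.prems by (simp_all add: z_def)
  note new = triple_new[OF Lam.prems(4,5) z]
  have U: "v_closed ?U" "r \<in> ?U" "v (v z) \<in> ?U" "v z \<in> ?U"
    using v_closed_triple Lam.prems z by (auto simp: triple_def)
  have ends: "?\<rho> b \<in> ?U \<or> e (?\<rho> b) = ?\<rho> b" if "b \<in> fv t" for b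
    using Lam.prems(7)[of b] that U(4) by auto
  have t: "decodes ?\<rho> (v (v z)) t" "fresh ?U (v (v z)) t" "uses_once t" and a: "a \<in> fv t"
    using Lam.prems by (simp_all add: z_def)
  have "tight ?U (v (v z)) t" by (rule Lam.IH[OF t U(1,2,3) ends])
  moreover have "v z \<in> conn ?U (v (v z))"
    using fv_in_conn[OF t(1,2) U(1) _ a] z by simp
  \<comment> \<open>A fixed parameter would receive its own occurrence and so be met inside the
    body, although its vertex has been cut.\<close>
  moreover have "e (v z) \<noteq> v z"
  proof
    assume "e (v z) = v z"
    then have "v z \<in> insert (v (v z)) (verts (v (v z)) t)"
      using fixed_in_hull[OF t(1) _ a] z by simp
    then show False using fresh_verts[OF t(2) U(1)] z U(4) new by auto
  qed
  ultimately show ?case using z by (simp add: z_def)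
qed

section \<open>Renaming to the names of elements\<close>

lemma tight_params: "tight U x t \<Longrightarrow> v_closed U \<Longrightarrow> x \<in> A \<Longrightarrow>
    params x t \<subseteq> A \<and> params x t \<inter> U = {} \<and> (\<forall>y\<in>params x t. e y \<noteq> y)"
proof (induction t arbitrary: U x)
  case (App t u)
  have "v_closed (U \<union> triple (e x))" using v_closed_triple App.prems by simp
  then show ?case using App.IH(1)[of "U \<union> triple (e x)" "v (v (e x))"]
      App.IH(2)[of "U \<union> triple (e x)" "v (e x)"] App.prems by auto
next
  case (Lam a t)
  have "v_closed (U \<union> triple (e x))" using v_closed_triple Lam.prems by simp
  moreover have "v (e x) \<notin> U" using Lam.prems v_closed_iff by simp
  ultimately show ?case using Lam.IH[of "U \<union> triple (e x)" "v (v (e x))"] Lam.prems by auto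
qed simp

text \<open>Bodies are renamed before their abstractions. The new name is then fresh: names below
  are original ones or belong to deeper parameters, which by \<open>tight_params\<close> avoid the
  vertices cut above.\<close>

lemma bound_changes_named:
  assumes "inj_on nm A"
  shows "tight U x t \<Longrightarrow> v_closed U \<Longrightarrow> x \<in> A \<Longrightarrow> nm ` A \<inter> vars t = {} \<Longrightarrow>
    \<exists>t'. bound_change\<^sup>*\<^sup>* t t' \<and> named nm x t' \<and> vars t' \<subseteq> vars t \<union> nm ` params x t"
proof (induction t arbitrary: U x)
  case (Var a)
  show ?case by (rule exI[of _ "Var a"]) simp
next
  case (App t u)
  have U: "v_closed (U \<union> triple (e x))" using v_closed_triple App.prems by simp
  have "nm ` A \<inter> vars t = {}" "nm ` A \<inter> vars u = {}" using App.prems(4) by auto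
  then obtain t' u' where "bound_change\<^sup>*\<^sup>* t t' \<and> named nm (v (v (e x))) t' \<and>
      vars t' \<subseteq> vars t \<union> nm ` params (v (v (e x))) t"
    "bound_change\<^sup>*\<^sup>* u u' \<and> named nm (v (e x)) u' \<and> vars u' \<subseteq> vars u \<union> nm ` params (v (e x)) u"
    using App.IH(1)[OF _ U] App.IH(2)[OF _ U] App.prems by (metis e_in v_in tight.simps(2))
  then show ?case by (intro exI[of _ "App t' u'"]) (auto intro: bound_changes_app)
next
  case (Lam a t)
  define z where "z = e x"
  have z: "z \<in> A" using Lam.prems by (simp add: z_def)
  have U: "v_closed (U \<union> triple z)" using v_closed_triple Lam.prems z by simp
  have t: "tight (U \<union> triple z) (v (v z)) t" using Lam.prems by (simp add: z_def)
  have "nm ` A \<inter> vars t = {}" using Lam.prems(4) by auto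
  then obtain t' where t': "bound_change\<^sup>*\<^sup>* t t'" "named nm (v (v z)) t'"
      "vars t' \<subseteq> vars t \<union> nm ` params (v (v z)) t"
    using Lam.IH[OF t U] z by auto
  have "v z \<notin> params (v (v z)) t" "params (v (v z)) t \<subseteq> A"
    using tight_params[OF t U] z by (auto simp: triple_def)
  then have "nm (v z) \<notin> nm ` params (v (v z)) t" using assms z by (auto dest: inj_onD)
  moreover have "nm (v z) \<notin> vars t" using \<open>nm ` A \<inter> vars t = {}\<close> z by blast
  ultimately have "nm (v z) \<notin> vars t'" using t'(3) by blast
  then have "bound_change (Lam a t') (Lam (nm (v z)) (rename a (nm (v z)) t'))"
    by (rule bound_change.here)
  then have "bound_change\<^sup>*\<^sup>* (Lam a t) (Lam (nm (v z)) (rename a (nm (v z)) t'))"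
    using bound_changes_lam[OF t'(1)] by (rule rtranclp.rtrancl_into_rtrancl[rotated])
  moreover have "vars (rename a (nm (v z)) t') \<subseteq> insert (nm (v z)) (vars t')" by (rule vars_rename)
  ultimately show ?case using t'
    by (intro exI[of _ "Lam (nm (v z)) (rename a (nm (v z)) t')"])
      (auto simp: named_rename z_def)
qed

text \<open>\<open>\<Phi>\<close> holds the names already replaced. All new names avoid all old
  ones, so variables can be replaced singly, and the listed elements stay the same.\<close>

lemma free_renaming:
  assumes "length \<Gamma> = length \<Delta>" "linear (\<Phi> @ \<Gamma>) t" "distinct \<Delta>"
    "set \<Delta> \<inter> (set (\<Phi> @ \<Gamma>) \<union> vars t) = {}" "decodes \<rho> x t" "named nm x t" "tight U x t"
  shows "\<exists>t' \<sigma>. alpha_equiv (\<Phi> @ \<Gamma>, t) (\<Phi> @ \<Delta>, t') \<and> linear (\<Phi> @ \<Delta>) t' \<and>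
    decodes \<sigma> x t' \<and> named nm x t' \<and> tight U x t' \<and> map \<sigma> (\<Phi> @ \<Delta>) = map \<rho> (\<Phi> @ \<Gamma>)"
  using assms
proof (induction \<Gamma> \<Delta> arbitrary: \<Phi> t \<rho> rule: list_induct2)
  case Nil
  then show ?case by (intro exI[of _ t] exI[of _ \<rho>]) (simp add: alpha_equiv_def)
next
  case (Cons a \<Gamma> b \<Delta>)
  let ?t = "rename a b t" and ?\<rho> = "\<rho>(b := \<rho> a)"
  have b: "b \<notin> set (\<Phi> @ \<Gamma>) \<union> vars t" "b \<notin> vars t" using Cons.prems by auto
  have step: "alpha_equiv (\<Phi> @ a # \<Gamma>, t) (\<Phi> @ b # \<Gamma>, ?t)"
    unfolding alpha_equiv_def
    using Cons.prems(1) b by (intro r_into_equivclp alpha_step.free)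
  have "\<exists>t' \<sigma>. alpha_equiv ((\<Phi> @ [b]) @ \<Gamma>, ?t) ((\<Phi> @ [b]) @ \<Delta>, t') \<and> linear ((\<Phi> @ [b]) @ \<Delta>) t' \<and>
    decodes \<sigma> x t' \<and> named nm x t' \<and> tight U x t' \<and> map \<sigma> ((\<Phi> @ [b]) @ \<Delta>) = map ?\<rho> ((\<Phi> @ [b]) @ \<Gamma>)"
  proof (rule Cons.IH)
    have "a \<in> fv t" using Cons.prems(1) by (auto simp: linear_iff)
    then show "linear ((\<Phi> @ [b]) @ \<Gamma>) ?t"
      using Cons.prems(1) b by (auto simp: linear_iff fv_rename uses_once_rename)
    show "decodes ?\<rho> x ?t" using Cons.prems(4) by (simp only: decodes_rename[OF b(2)])
    show "set \<Delta> \<inter> (set ((\<Phi> @ [b]) @ \<Gamma>) \<union> vars ?t) = {}"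
      using Cons.prems(2,3) vars_rename[of a b t] by auto
  qed (use Cons.prems b in \<open>auto simp: decodes_rename named_rename tight_rename\<close>)
  then obtain t' \<sigma> where t': "alpha_equiv (\<Phi> @ b # \<Gamma>, ?t) (\<Phi> @ b # \<Delta>, t')" "linear (\<Phi> @ b # \<Delta>) t'"
    "decodes \<sigma> x t'" "named nm x t'" "tight U x t'" "map \<sigma> (\<Phi> @ b # \<Delta>) = map ?\<rho> (\<Phi> @ b # \<Gamma>)"
    by auto
  have "map ?\<rho> (\<Phi> @ b # \<Gamma>) = map \<rho> (\<Phi> @ a # \<Gamma>)" using b by auto
  then show ?case using t' step unfolding alpha_equiv_def by (metis equivclp_trans)
qed

text \<open>The normal form relative to \<open>nm\<close>: it satisfies what
  \<open>tight_unique\<close> demands, and its context depends on the map and \<open>nm\<close>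
  only.\<close>

lemma alpha_canonical:
  assumes lin: "linear \<Gamma> t" and iso: "rtmap_iso (underlying_map \<Gamma> t) M f"
    and nm: "inj_on nm A" "nm ` A \<inter> vars t = {}"
  obtains t' \<rho> where "alpha_equiv (\<Gamma>, t) (map nm (boundary M), t')"
    "decodes \<rho> r t'" "named nm r t'" "tight {r} r t'" "\<And>a. a \<in> fv t' \<Longrightarrow> nm (\<rho> a) = a"
proof -
  have r: "v_closed {r}" by (simp add: v_closed_def)
  obtain \<rho> where \<rho>: "decodes \<rho> r t" "fresh {r} r t" "map \<rho> \<Gamma> = boundary M"
    using iso_decodes[OF lin iso] .
  have once: "uses_once t" and \<Gamma>: "set \<Gamma> = fv t" using lin by (auto simp: linear_iff)
  have "e (\<rho> a) = \<rho> a" if "a \<in> fv t" for a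
    using that \<rho>(3) \<Gamma> boundary_in by (metis imageI list.set_map)
  then have tight: "tight {r} r t"
    by (intro decodes_tight[OF \<rho>(1,2) once r]) auto
  obtain s where s: "bound_change\<^sup>*\<^sup>* t s" "named nm r s" "vars s \<subseteq> vars t \<union> nm ` params r t"
    using bound_changes_named[OF nm(1) tight r _ nm(2)] by auto
  have alpha: "linear \<Gamma> s" "alpha_equiv (\<Gamma>, t) (\<Gamma>, s)"
    using bound_changes_alpha[OF s(1) lin] by auto
  from s(1) have "decodes \<rho> r s \<and> tight {r} r s"
    by induction (use \<rho>(1) tight in \<open>simp_all add: bound_change_decodes bound_change_tight\<close>)
  then have dec: "decodes \<rho> r s" "tight {r} r s" by auto
  let ?\<Delta> = "map nm (boundary M)"
  have bA: "set (boundary M) \<subseteq> A" using boundary_in by blast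
  have "distinct ?\<Delta>" using distinct_boundary nm(1) bA by (auto simp: distinct_map inj_on_subset)
  \<comment> \<open>Boundary elements are fixed by \<open>e\<close> and parameters are not, so the
    names for free and for bound variables differ.\<close>
  have p: "params r t \<subseteq> A" "set (boundary M) \<inter> params r t = {}"
    using tight_params[OF tight r r_in] boundary_in by auto
  have sep: "N \<inter> P = {} \<Longrightarrow> N \<inter> T = {} \<Longrightarrow> G \<union> S \<subseteq> T \<union> P \<Longrightarrow> N \<inter> (G \<union> S) = {}"
    for N P T G S :: "nat set" by blast
  have "nm ` set (boundary M) \<inter> nm ` params r t = {}"
    using inj_on_image_Int[OF nm(1) bA p(1)] p(2) by simp
  moreover have "nm ` set (boundary M) \<inter> vars t = {}"
    using nm(2) image_mono[OF bA, of nm] by (simp add: disjoint_iff subset_iff)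
  moreover have "set \<Gamma> \<union> vars s \<subseteq> vars t \<union> nm ` params r t"
    using s(3) \<Gamma> fv_subset_vars[of t] by simp blast
  ultimately have disj: "set ?\<Delta> \<inter> (set ([] @ \<Gamma>) \<union> vars s) = {}"
    unfolding set_map append_Nil by (rule sep)
  have "length \<Gamma> = length ?\<Delta>" using \<rho>(3) by (metis length_map)
  then obtain t' \<sigma> where t': "alpha_equiv (\<Gamma>, s) (?\<Delta>, t')" "linear ?\<Delta> t'" "decodes \<sigma> r t'"
    "named nm r t'" "tight {r} r t'" "map \<sigma> ?\<Delta> = map \<rho> \<Gamma>"
    using free_renaming[of \<Gamma> ?\<Delta> "[]" s \<rho> r nm "{r}"] alpha(1) \<open>distinct ?\<Delta>\<close> disj dec s(2) by auto
  have "nm (\<sigma> a) = a" if a: "a \<in> fv t'" for a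
  proof -
    have "a \<in> set ?\<Delta>" using t'(2) a by (simp add: linear_iff)
    then obtain b where b: "b \<in> set (boundary M)" "a = nm b" by auto
    have "map (\<sigma> \<circ> nm) (boundary M) = map id (boundary M)" using t'(6) \<rho>(3) by simp
    then have "\<sigma> (nm b) = b" using b(1) by (metis comp_apply id_apply map_eq_conv)
    then show ?thesis using b by simp
  qed
  moreover have "alpha_equiv (\<Gamma>, t) (?\<Delta>, t')"
    using alpha(2) t'(1) unfolding alpha_equiv_def by (rule equivclp_trans)
  ultimately show ?thesis using that t' by blast
qed

lemma inj_avoiding:
  assumes "finite A" "finite X"
  obtains nm :: "'a \<Rightarrow> nat" where "inj_on nm A" "nm ` A \<inter> X = {}"
proof -
  obtain f :: "'a \<Rightarrow> nat" where f: "inj_on f A" using finite_imp_inj_to_nat_seg[OF assms(1)] by blast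
  \<comment> \<open>The shift passes every element of \<open>X\<close>. For empty \<open>X\<close>
    the value \<open>Max X\<close> is unspecified, but then avoiding \<open>X\<close> is
    vacuous.\<close>
  have "inj_on (\<lambda>x. Suc (Max X + f x)) A" using f by (auto simp: inj_on_def)
  moreover have "Suc (Max X + f x) \<notin> X" for x using Max_ge[OF assms(2)] by fastforce
  ultimately show ?thesis using that[of "\<lambda>x. Suc (Max X + f x)"] by blast
qed

lemma alpha_unique:
  assumes "finite A"
    and t: "linear \<Gamma> t" "rtmap_iso (underlying_map \<Gamma> t) M f"
    and t': "linear \<Gamma>' t'" "rtmap_iso (underlying_map \<Gamma>' t') M f'"
  shows "alpha_equiv (\<Gamma>, t) (\<Gamma>', t')"
proof -
  obtain nm :: "'a \<Rightarrow> nat" where nm: "inj_on nm A" "nm ` A \<inter> (vars t \<union> vars t') = {}"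
    using inj_avoiding[OF assms(1), of "vars t \<union> vars t'"] finite_vars by auto
  then have "nm ` A \<inter> vars t = {}" "nm ` A \<inter> vars t' = {}" by auto
  \<comment> \<open>The same \<open>nm\<close>, avoiding the variables of both terms, is used twice,
    so that the two normal forms are comparable.\<close>
  note c = alpha_canonical[OF t nm(1) this(1)] alpha_canonical[OF t' nm(1) this(2)]
  obtain s \<rho> where s: "alpha_equiv (\<Gamma>, t) (map nm (boundary M), s)"
    "decodes \<rho> r s" "named nm r s" "tight {r} r s" "\<And>a. a \<in> fv s \<Longrightarrow> nm (\<rho> a) = a"
    by (rule c(1)) (rule that)
  obtain s' \<rho>' where s': "alpha_equiv (\<Gamma>', t') (map nm (boundary M), s')"
    "decodes \<rho>' r s'" "named nm r s'" "tight {r} r s'" "\<And>a. a \<in> fv s' \<Longrightarrow> nm (\<rho>' a) = a"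
    by (rule c(2)) (rule that)
  have "s = s'" using tight_unique[OF s(4) s'(4) s(2) s'(2) s(3) s'(3) s(5) s'(5)] .
  then show ?thesis using s(1) s'(1) unfolding alpha_equiv_def
    by (metis equivclp_sym equivclp_trans)
qed

end

theorem theorem1:
  fixes M :: "'a rtmap" and k n :: nat
  assumes "rooted_trivalent_map M"
    and "degree M = k"
    and "finite (trivalent_vertices M)" and "card (trivalent_vertices M) = n"
  shows "\<exists>\<Gamma> t. linear \<Gamma> t \<and> length \<Gamma> = k \<and>
      (\<exists>p q. apps t = p \<and> lams t = q \<and> p + q = n) \<and>
      rtmap_isomorphic (underlying_map \<Gamma> t) M \<and>
      (\<forall>\<Gamma>' t'. linear \<Gamma>' t' \<and> rtmap_isomorphic (underlying_map \<Gamma>' t') M \<longrightarrow>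
        alpha_equiv (\<Gamma>, t) (\<Gamma>', t'))"
proof -
  interpret trivalent_map M by (rule trivalent_map.intro) (rule assms(1))
  have fin: "finite A" and card: "card A = 1 + 3 * n" using card_carrier assms(3,4) by auto
  obtain nm :: "'a \<Rightarrow> nat" where nm: "inj_on nm A" using inj_avoiding[OF fin, of "{}"] by auto
  obtain t where t: "linear (map nm (boundary M)) t"
    "rtmap_iso (underlying_map (map nm (boundary M)) t) M place"
    using term_exists[OF fin nm] .
  \<comment> \<open>Both sides are one plus three times a number of vertices, which gives
    \<open>p + q = n\<close>.\<close>
  have "card (elts t) = card A"
    using t(2) by (auto simp: rtmap_iso_def underlying_map_def dest: bij_betw_same_card)
  then have "apps t + lams t = n" using card card_elts(2)[of t] by simp
  moreover have "length (map nm (boundary M)) = k" using assms(2) by (simp add: degree_def)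
  moreover have "alpha_equiv (map nm (boundary M), t) (\<Gamma>', t')"
    if "linear \<Gamma>' t'" "rtmap_isomorphic (underlying_map \<Gamma>' t') M" for \<Gamma>' t'
    using that alpha_unique[OF fin t] by (auto simp: rtmap_isomorphic_def)
  ultimately show ?thesis using t unfolding rtmap_isomorphic_def by blast
qed

end
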